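(* Let $w$ be a permutation with final descent at position $k$. Then $$\mathfrak{S}_w(x_1,\ldots,x_{k-1},0)=\sum_{\substack{u=\hat w\,(a_1,k)\cdots(a_m,k+m-1)\\ a_i<k\ \text{and}\ \ell(u)=\ell(w)}}\mathfrak{S}_u,$$ where $k+m=\max\{i\mid w_k>w_i\}$ and $\hat w=w_1\cdots w_{k-1}\,w_{k+1}\cdots w_{k+m}\,w_k$.
   Context: Permutations are bijections $w$ of $\{1,2,3,\ldots\}$ fixing all but finitely many elements, written in one-line notation $w=w_1w_2\cdots$; $\ell(w)$ is the length (number of inversions) of $w$. The final descent of $w$ is at position $k$ if $w_k>w_{k+1}$ and $w_i<w_{i+1}$ for all $i>k$. In the one-line notation given for $\hat w$, the entries in positions beyond $k+m$ are those of $w$; that is, $\hat w$ is obtained from $w$ by moving the entry $w_k$ to position $k+m$ and shifting $w_{k+1},\ldots,w_{k+m}$ one position to the left. For $a<b$, $w(a,b)$ denotes the permutation obtained from $w$ by exchanging the entries in positions $a$ and $b$; a product of several transpositions is applied in this way from left to right, so the $i$th transposition in the product defining $u$ is $(a_i,k+i-1)$, for $i=1,\ldots,m$. Schubert polynomial: a reduced expression for $w$ is a sequence $\rho=(i_p,\ldots,i_1)$ of positive integers with $p=\ell(w)$ such that, starting from the one-line notation of the identity and successively exchanging the entries in positions $i_1,i_1+1$, then in positions $i_2,i_2+1$, and so on up to positions $i_p,i_p+1$, one obtains $w$. Write $\rho_j=i_j$, and let $R(w)$ be the set of reduced expressions for $w$. A sequence $\alpha=(\alpha_1,\ldots,\alpha_{\ell(w)})$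 of positive integers is $\rho$-compatible if $\alpha$ is weakly increasing, $\alpha_j<\alpha_{j+1}$ whenever $\rho_j<\rho_{j+1}$, and $\alpha_j\le\rho_j$ for all $j$. Then $\mathfrak{S}_w=\sum_{\rho\in R(w)}\sum_{\alpha\ \rho\text{-compatible}}x_{\alpha_1}\cdots x_{\alpha_{\ell(w)}}$. If the final descent of $w$ is at position $k$, then $\mathfrak{S}_w$ is a polynomial in $x_1,\ldots,x_k$, and $\mathfrak{S}_w(x_1,\ldots,x_{k-1},0)$ is obtained by setting $x_k=0$.
   Formalization: The sum also requires each successive transposition to raise the length by exactly 1; with only ℓ(u)=ℓ(w) the formula fails: for w=2413 (k=m=2, ŵ=2134), u=ŵ(1,2)(1,3)=3214 would contribute x_1^2 x_2 while 𝔖_w(x_1,0)=0. *)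

theory Defs
  imports
    "HOL-Library.Poly_Mapping"
    "HOL-Combinatorics.Permutations"
begin

text \<open>
  A permutation of \<open>{1, 2, 3, \<dots>}\<close> is a function on \<^typ>\<open>nat\<close> that fixes the junk point \<open>0\<close>;
  the entry \<open>w\<^sub>i\<close> of the one-line notation is \<open>w i\<close>.
\<close>

definition is_perm :: "(nat \<Rightarrow> nat) \<Rightarrow> bool" where
  "is_perm w \<longleftrightarrow> w permutes {1..} \<and> finite {i. w i \<noteq> i}"

definition perm_length :: "(nat \<Rightarrow> nat) \<Rightarrow> nat" where
  "perm_length w = card {(i, j). 1 \<le> i \<and> i < j \<and> w i > w j}"

definition final_descent :: "(nat \<Rightarrow> nat) \<Rightarrow> nat \<Rightarrow> bool" where
  "final_descent w k \<longleftrightarrow> 1 \<le> k \<and> w k > w (k + 1) \<and> (\<forall>i>k. w i < w (i + 1))"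

text \<open>Exchanging positions (not values) is composition on the right.\<close>

definition exchange :: "(nat \<Rightarrow> nat) \<Rightarrow> nat \<Rightarrow> nat \<Rightarrow> (nat \<Rightarrow> nat)" where
  "exchange w a b = w \<circ> transpose a b"

text \<open>
  A reduced expression \<open>(i\<^sub>p, \<dots>, i\<^sub>1)\<close> is stored as the list \<open>[i\<^sub>1, \<dots>, i\<^sub>p]\<close>, in the order in
  which the exchanges are carried out, so that \<open>\<rho>\<^sub>j = i\<^sub>j\<close> is \<open>\<rho> ! (j - 1)\<close>.
\<close>

definition reduced_expressions :: "(nat \<Rightarrow> nat) \<Rightarrow> nat list set" where
  "reduced_expressions w =
     {\<rho>. length \<rho> = perm_length w \<and> (\<forall>i\<in>set \<rho>. 1 \<le> i) \<and>
         fold (\<lambda>i v. exchange v i (i + 1)) \<rho> id = w}"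

definition compatible :: "nat list \<Rightarrow> nat list set" where
  "compatible \<rho> =
     {\<alpha>. length \<alpha> = length \<rho> \<and> (\<forall>i\<in>set \<alpha>. 1 \<le> i) \<and> sorted \<alpha> \<and>
         (\<forall>j. Suc j < length \<rho> \<longrightarrow> \<rho> ! j < \<rho> ! Suc j \<longrightarrow> \<alpha> ! j < \<alpha> ! Suc j) \<and>
         (\<forall>j < length \<rho>. \<alpha> ! j \<le> \<rho> ! j)}"

text \<open>
  Integer polynomials in \<open>x\<^sub>1, x\<^sub>2, \<dots>\<close>: finitely supported maps from monomials, given by their
  exponents, to coefficients. The index \<open>0\<close> is never used.
\<close>

type_synonym int_mpoly = "(nat \<Rightarrow>\<^sub>0 nat) \<Rightarrow>\<^sub>0 int"

definition X :: "nat \<Rightarrow> int_mpoly" where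
  "X i = Poly_Mapping.single (Poly_Mapping.single i 1) 1"

definition mpoly_subst :: "(nat \<Rightarrow> int_mpoly) \<Rightarrow> int_mpoly \<Rightarrow> int_mpoly" where
  "mpoly_subst s p =
     (\<Sum>t\<in>Poly_Mapping.keys p. of_int (Poly_Mapping.lookup p t) *
        (\<Prod>i\<in>Poly_Mapping.keys t. s i ^ Poly_Mapping.lookup t i))"

definition set_var_zero :: "nat \<Rightarrow> int_mpoly \<Rightarrow> int_mpoly" where
  "set_var_zero k = mpoly_subst (\<lambda>i. if i = k then 0 else X i)"

definition schubert :: "(nat \<Rightarrow> nat) \<Rightarrow> int_mpoly" where
  "schubert w = (\<Sum>\<rho>\<in>reduced_expressions w. \<Sum>\<alpha>\<in>compatible \<rho>. prod_list (map X \<alpha>))"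

definition move_entry :: "(nat \<Rightarrow> nat) \<Rightarrow> nat \<Rightarrow> nat \<Rightarrow> (nat \<Rightarrow> nat)" where
  "move_entry w k m =
     (\<lambda>i. if k \<le> i \<and> i < k + m then w (i + 1) else if i = k + m then w k else w i)"

text \<open>
  The partial product \<open>v (a\<^sub>1, k) (a\<^sub>2, k + 1) \<cdots> (a\<^sub>i, k + i - 1)\<close>.
\<close>

primrec swaps :: "(nat \<Rightarrow> nat) \<Rightarrow> (nat \<Rightarrow> nat) \<Rightarrow> nat \<Rightarrow> nat \<Rightarrow> (nat \<Rightarrow> nat)" where
  "swaps v a k 0 = v"
| "swaps v a k (Suc i) = exchange (swaps v a k i) (a (Suc i)) (k + i)"

text \<open>
  Each of the \<open>m\<close> transpositions raises the length by one. For \<open>v = move_entry w k m\<close>, which has length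
  \<open>\<ell>(w) - m\<close>, this is how the condition \<open>\<ell>(u) = \<ell>(w)\<close> on \<open>u = v (a\<^sub>1, k) \<cdots> (a\<^sub>m, k + m - 1)\<close>
  has to be understood; the bare equation of lengths is strictly weaker and does not give a correct
  formula. For \<open>w = 2413\<close>, with \<open>k = m = 2\<close> and \<open>v = 2134\<close>, it admits
  \<open>u = v (1, 2) (1, 3) = 3214\<close>, reached through the lengths \<open>1, 0, 3\<close>, although the Schubert
  polynomial \<open>x\<^sub>1\<^sup>2 x\<^sub>2 + x\<^sub>1 x\<^sub>2\<^sup>2\<close> of \<open>w\<close> vanishes at \<open>x\<^sub>2 = 0\<close>.
\<close>

definition length_raising :: "(nat \<Rightarrow> nat) \<Rightarrow> (nat \<Rightarrow> nat) \<Rightarrow> nat \<Rightarrow> nat \<Rightarrow> bool" where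
  "length_raising v a k m \<longleftrightarrow>
     (\<forall>i<m. perm_length (swaps v a k (Suc i)) = perm_length (swaps v a k i) + 1)"

end

theory Submission
  imports Defs
begin

text \<open>
  Put \<open>n = k - 1\<close>. In a compatible sequence the last entry is at most the last letter of the
  reduced expression, and that letter is a descent of the permutation. So for \<open>w\<close> only
  \<open>x\<^sub>1, \<dots>, x\<^sub>k\<close> occur, and for the permutations \<open>u\<close> on the right, which increase from position
  \<open>k\<close> on, only \<open>x\<^sub>1, \<dots>, x\<^sub>n\<close>. Let \<open>P v\<close> be the part of the Schubert polynomial of \<open>v\<close> in
  which the compatible sequence stays in \<open>{1, \<dots>, n}\<close> (\<open>truncated_schubert\<close>); equivalently, all
  \<open>x\<^sub>c\<close> with \<open>c > n\<close> are set to \<open>0\<close>. Then the two sides are \<open>P w\<close> and \<open>\<Sum>\<^sub>u P u\<close>, values of one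
  function of a permutation, and the theorem becomes a linear relation among values of \<open>P\<close>.

  All relations used come from Monk's rule. For full Schubert polynomials it says that
  \<open>x\<^sub>c\<close> times the polynomial of \<open>v\<close> is the signed sum of the polynomials of the permutations
  that cover \<open>v\<close> in Bruhat order by an exchange at position \<open>c\<close>, with sign \<open>+\<close> if the other
  position lies to the right of \<open>c\<close> and \<open>-\<close> if it lies to the left. Since \<open>x\<^sub>c\<close> is zero in \<open>P\<close>
  for \<open>c \<ge> k\<close>, the signed sum of \<open>P\<close> vanishes there (\<open>monk_sum_truncated\<close>). This vanishing is
  proved directly from the definition by compatible sequences. Removing the letters that carry
  \<open>x\<^sub>n\<close> one at a time, smallest letter first, builds \<open>P\<close> from the same function for \<open>n - 1\<close> by
  the operators \<open>1 + x\<^sub>n \<partial>\<^sub>i\<close> (\<open>partial_schubert_step\<close>). The divided differences \<open>\<partial>\<^sub>i\<close> satisfy a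
  Leibniz rule with respect to the signed sums, which is a statement about covers in Bruhat
  order (\<open>monk_sum_divided_difference\<close>), and so the signed sums can be pushed through all these
  operators.

  The second half uses nothing about \<open>P\<close> but this vanishing. Write \<open>v\<close> for the permutation
  obtained from \<open>w\<close> by moving the entry at \<open>k\<close> to position \<open>k + m\<close>; it increases from position \<open>k\<close>
  on. Then \<open>P w\<close> is the sum of \<open>P\<close> over the ends of all chains of covers from \<open>v\<close> at positions
  \<open>k, k + 1, \<dots>, k + m - 1\<close> with the other position left of \<open>k\<close> (\<open>insert_entry_chain_sum\<close>). The
  induction on \<open>m\<close> replaces \<open>k\<close> by \<open>k + 1\<close>: the vanishing sum at position \<open>k\<close> yields chains in
  which position \<open>k\<close> too may be exchanged with later positions, and the unwanted chains cancel in
  pairs. Finally a chain is determined by its end, as the last exchange places the entry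
  \<open>v (k + m - 1)\<close> at the position \<open>a\<^sub>m\<close>; hence the sum over chains is a sum over
  permutations (\<open>chain_sum_eq_sum_chain_ends\<close>).
\<close>

section \<open>Permutations, exchanges and length\<close>

lemma is_perm_inj: "is_perm v \<Longrightarrow> inj v"
  by (auto simp: is_perm_def permutes_inj)

lemma is_perm_id: "is_perm id"
  by (simp add: is_perm_def permutes_id)

lemma is_perm_bounded:
  assumes "is_perm v"
  obtains N where "\<forall>j\<ge>N. v j = j"
proof -
  have "finite {i. v i \<noteq> i}" using assms by (simp add: is_perm_def)
  then obtain N where "\<forall>i\<in>{i. v i \<noteq> i}. i < N"
    using finite_nat_set_iff_bounded by blast
  then show ?thesis using that[of N] by force
qed

lemma is_perm_exchange:
  assumes "is_perm v" "1 \<le> a" "1 \<le> b"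
  shows "is_perm (exchange v a b)"
proof -
  have "transpose a b permutes {1..}"
    using assms by (intro permutes_swap_id) auto
  then have "exchange v a b permutes {1..}"
    using assms unfolding exchange_def is_perm_def by (intro permutes_compose) auto
  moreover have "{i. exchange v a b i \<noteq> i} \<subseteq> {i. v i \<noteq> i} \<union> {a, b}"
    by (auto simp: exchange_def transpose_def)
  then have "finite {i. exchange v a b i \<noteq> i}"
    by (rule finite_subset) (use assms in \<open>auto simp: is_perm_def\<close>)
  ultimately show ?thesis by (simp add: is_perm_def)
qed

lemma exchange_apply:
  "exchange v a b x = (if x = a then v b else if x = b then v a else v x)"
  by (simp add: exchange_def transpose_def)

lemma exchange_commute: "exchange v a b = exchange v b a"
  by (simp add: exchange_def transpose_commute)

lemma exchange_exchange [simp]: "exchange (exchange v a b) a b = v"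
  by (simp add: exchange_def o_assoc [symmetric])

lemma exchange_conj:
  "exchange (exchange v c d) i j = exchange (exchange v i j) (transpose i j c) (transpose i j d)"
  by (rule ext) (auto simp: exchange_apply transpose_def)

lemma fixed_tail_less:
  assumes "is_perm v" "\<forall>j\<ge>N. v j = j" "a < N"
  shows "v a < N"
  using assms is_perm_inj[OF assms(1)] by (metis injD leI not_le)

definition inversions :: "(nat \<Rightarrow> nat) \<Rightarrow> (nat \<times> nat) set" where
  "inversions w = {(i, j). 1 \<le> i \<and> i < j \<and> w i > w j}"

lemma perm_length_inversions: "perm_length w = card (inversions w)"
  by (simp add: perm_length_def inversions_def)

lemma finite_inversions:
  assumes "is_perm v" shows "finite (inversions v)"
proof -
  obtain N where N: "\<forall>j\<ge>N. v j = j" using is_perm_bounded[OF assms] by blast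
  have "j < N" if "(i, j) \<in> inversions v" for i j
  proof (rule ccontr)
    assume "\<not> j < N"
    then have "v j = j" using N by simp
    then have "v i > j" "i < j" using that by (auto simp: inversions_def)
    then show False
      using fixed_tail_less[OF assms N, of i] N \<open>\<not> j < N\<close>
      by (metis le_less_linear less_trans not_less_iff_gr_or_eq)
  qed
  then have "inversions v \<subseteq> {..<N} \<times> {..<N}"
    by (fastforce simp: inversions_def)
  then show ?thesis by (rule finite_subset) auto
qed

lemma perm_length_id: "perm_length id = 0"
proof -
  have "inversions id = {}" by (auto simp: inversions_def)
  then show ?thesis by (simp add: perm_length_inversions)
qed

lemma perm_length_adjacent:
  assumes v: "is_perm v" and i: "1 \<le> i" and asc: "v i < v (i + 1)"
  shows "perm_length (exchange v i (i + 1)) = perm_length v + 1"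
proof -
  let ?s = "transpose i (i + 1)"
  have "inversions (exchange v i (i + 1))
          = insert (i, i + 1) (map_prod ?s ?s ` inversions v)" (is "?L = insert _ ?R")
  proof (intro subset_antisym subsetI)
    fix p assume p: "p \<in> ?L"
    obtain x y where xy: "p = (x, y)" by force
    show "p \<in> insert (i, i + 1) ?R"
    proof (cases "x = i \<and> y = i + 1")
      case False
      then have "(?s x, ?s y) \<in> inversions v"
        using p xy i by (auto simp: inversions_def exchange_def transpose_def split: if_splits)
      then have "map_prod ?s ?s (?s x, ?s y) \<in> ?R" by blast
      then show ?thesis using xy by simp
    qed (use xy in simp)
  next
    fix p assume "p \<in> insert (i, i + 1) ?R"
    then show "p \<in> ?L"
      using i asc by (auto simp: inversions_def exchange_def transpose_def split: if_splits)
  qed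
  moreover have "(i, i + 1) \<notin> ?R"
    using asc by (auto simp: inversions_def transpose_def split: if_splits)
  moreover have "inj_on (map_prod ?s ?s) (inversions v)"
    by (rule inj_onI) (metis map_prod_simp prod.collapse prod.inject transpose_involutory)
  ultimately show ?thesis
    using finite_inversions[OF v] by (simp add: perm_length_inversions card_image)
qed

lemma perm_length_adjacent_descent:
  assumes v: "is_perm v" and i: "1 \<le> i" and desc: "v (i + 1) < v i"
  shows "perm_length v = perm_length (exchange v i (i + 1)) + 1"
  using perm_length_adjacent[OF is_perm_exchange[OF v, of i "i + 1"], of i] i desc
  by (simp add: exchange_apply)

text \<open>
  Exchanging \<open>a\<close> and \<open>b\<close> is exchanging \<open>a\<close> and \<open>b - 1\<close>, conjugated by the adjacent exchange of
  \<open>b - 1\<close> and \<open>b\<close>. The two conjugating steps change the length in opposite directions unless the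
  entry at \<open>b - 1\<close> lies between those at \<open>a\<close> and \<open>b\<close>; then both raise it by one.
\<close>

lemma perm_length_exchange:
  assumes "is_perm v" "1 \<le> a" "a < b" "v a < v b"
  shows "perm_length (exchange v a b)
           = perm_length v + 1 + 2 * card {c. a < c \<and> c < b \<and> v a < v c \<and> v c < v b}"
  using assms
proof (induction "b - a" arbitrary: b v)
  case 0
  then show ?case by simp
next
  case (Suc d)
  note v = Suc.prems(1) and a = Suc.prems(2) and ab = Suc.prems(3) and vab = Suc.prems(4)
  show ?case
  proof (cases "b = a + 1")
    case True
    then have "{c. a < c \<and> c < b \<and> v a < v c \<and> v c < v b} = {}" by auto
    then show ?thesis using perm_length_adjacent v a vab True by simp
  next
    case False
    define r where "r = b - 1"
    have b: "b = r + 1" and ar: "a < r" using False ab by (auto simp: r_def)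
    define y where "y = exchange v r (r + 1)"
    define z where "z = exchange y a r"
    have py: "is_perm y" using is_perm_exchange[OF v] a ar by (simp add: y_def)
    have pz: "is_perm z" using is_perm_exchange[OF py] a ar by (simp add: z_def)
    have yv: "y a = v a" "y r = v b" "y (r + 1) = v r" using ar b by (auto simp: y_def exchange_apply)
    have zv: "z r = v a" "z (r + 1) = v r" using ar yv by (auto simp: z_def exchange_apply)
    have vz: "exchange v a b = exchange z r (r + 1)"
      unfolding z_def y_def b by (rule ext) (use ar in \<open>simp add: exchange_apply\<close>)
    have ne: "v r \<noteq> v a" "v r \<noteq> v b"
      using ar b by (simp_all add: inj_eq[OF is_perm_inj[OF v]])
    let ?B = "{c. a < c \<and> c < r \<and> y a < y c \<and> y c < y r}"
    have B: "?B = {c. a < c \<and> c < r \<and> v a < v c \<and> v c < v b}"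
      using yv by (auto simp: y_def exchange_apply)
    have IH: "perm_length z = perm_length y + 1 + 2 * card ?B"
      unfolding z_def using Suc.hyps(1)[of r y] Suc.hyps(2) py a ar b yv vab by auto
    have split: "{c. a < c \<and> c < b \<and> v a < v c \<and> v c < v b}
                   = ?B \<union> (if v a < v r \<and> v r < v b then {r} else {})"
      unfolding B using ar b by (auto simp: less_Suc_eq)
    have card: "card {c. a < c \<and> c < b \<and> v a < v c \<and> v c < v b}
                  = card ?B + (if v a < v r \<and> v r < v b then 1 else 0)"
      unfolding split by (auto simp: card_insert_if)
    (* The first and the last of the three exchanges, each in both directions. *)
    have up_y: "v r < v b \<Longrightarrow> perm_length y = perm_length v + 1"
      using perm_length_adjacent[OF v, of r] ar b by (simp add: y_def)
    have down_y: "v b < v r \<Longrightarrow> perm_length v = perm_length y + 1"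
      using perm_length_adjacent_descent[OF v, of r] ar b by (simp add: y_def)
    have up_z: "v a < v r \<Longrightarrow> perm_length (exchange v a b) = perm_length z + 1"
      using perm_length_adjacent[OF pz, of r] ar zv vz by simp
    have down_z: "v r < v a \<Longrightarrow> perm_length z = perm_length (exchange v a b) + 1"
      using perm_length_adjacent_descent[OF pz, of r] ar zv vz by simp
    consider "v r < v a" | "v a < v r" "v r < v b" | "v b < v r"
      using ne by linarith
    then show ?thesis
      using IH card up_y down_y up_z down_z vab by cases auto
  qed
qed

text \<open>
  The covering relation of the Bruhat order, in terms of entries: the arguments below compare
  individual entries, and \<open>rises_iff_length\<close> makes the link with lengths.
\<close>

definition rises :: "(nat \<Rightarrow> nat) \<Rightarrow> nat \<Rightarrow> nat \<Rightarrow> bool" where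
  "rises v a b \<longleftrightarrow> 1 \<le> a \<and> a < b \<and> v a < v b \<and>
     (\<forall>e. a < e \<and> e < b \<longrightarrow> \<not> (v a < v e \<and> v e < v b))"

lemma rises_iff_length:
  assumes v: "is_perm v" and ab: "1 \<le> a" "a < b"
  shows "rises v a b \<longleftrightarrow> perm_length (exchange v a b) = perm_length v + 1"
proof (cases "v a < v b")
  case True
  have "finite {c. a < c \<and> c < b \<and> v a < v c \<and> v c < v b}"
    by (rule finite_subset[of _ "{..<b}"]) auto
  then show ?thesis
    using perm_length_exchange[OF v ab True] True ab
    by (auto simp: rises_def card_eq_0_iff)
next
  case False
  then have "v b < v a"
    using is_perm_inj[OF v] ab by (metis injD less_irrefl nat_neq_iff)
  then have "perm_length v > perm_length (exchange v a b)"
    using perm_length_exchange[OF is_perm_exchange[OF v, of a b] ab] ab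
    by (simp add: exchange_apply)
  then show ?thesis using False by (simp add: rises_def)
qed

section \<open>Monk sums and divided differences\<close>

definition cover :: "(nat \<Rightarrow> nat) \<Rightarrow> nat \<Rightarrow> nat \<Rightarrow> bool" where
  "cover v c d \<longleftrightarrow> rises v c d \<or> rises v d c"

text \<open>
  By Monk's rule, for \<open>Q = schubert\<close> this is \<open>x\<^sub>c\<close> times the Schubert polynomial of \<open>v\<close>. With \<open>Q\<close> as an
  argument, operators on formal linear combinations of permutations turn into operators on
  functions of a permutation, composed in the opposite order.
\<close>

definition monk_sum :: "((nat \<Rightarrow> nat) \<Rightarrow> 'r::comm_ring_1) \<Rightarrow> nat \<Rightarrow> (nat \<Rightarrow> nat) \<Rightarrow> 'r" where
  "monk_sum Q c v = (\<Sum>d | cover v c d. (if c < d then 1 else - 1) * Q (exchange v c d))"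

text \<open>
  For \<open>Q = schubert\<close> this is the Newton divided difference in \<open>x\<^sub>i\<close> and \<open>x\<^bsub>i + 1\<^esub>\<close> of the Schubert
  polynomial of \<open>v\<close>.
\<close>

definition divided_difference :: "((nat \<Rightarrow> nat) \<Rightarrow> 'r::comm_ring_1) \<Rightarrow> nat \<Rightarrow> (nat \<Rightarrow> nat) \<Rightarrow> 'r" where
  "divided_difference Q i v = (if v (i + 1) < v i then Q (exchange v i (i + 1)) else 0)"

lemma cover_bound:
  assumes v: "is_perm v" "\<forall>j\<ge>N. v j = j" and c: "c < N" and cover: "cover v c d"
  shows "d \<le> N"
proof (rule ccontr)
  assume "\<not> d \<le> N"
  then have d: "N < d" by simp
  then have "rises v c d" using cover c by (auto simp: cover_def rises_def)
  then have "\<not> (v c < v N \<and> v N < v d)" using c d by (auto simp: rises_def)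
  then show False using fixed_tail_less[OF v c] v(2) d by simp
qed

lemma finite_covers:
  assumes "is_perm v" shows "finite {d. cover v c d}"
proof -
  obtain N where N: "\<forall>j\<ge>N. v j = j" using is_perm_bounded[OF assms] by blast
  then have "d \<le> max N (c + 1)" if "cover v c d" for d
    using cover_bound[OF assms, of "max N (c + 1)" c d] that by simp
  then have "{d. cover v c d} \<subseteq> {..max N (c + 1)}" by blast
  then show ?thesis by (rule finite_subset) simp
qed

lemma is_perm_exchange_cover: "is_perm v \<Longrightarrow> cover v c d \<Longrightarrow> is_perm (exchange v c d)"
  by (rule is_perm_exchange) (auto simp: cover_def rises_def)

lemma monk_sum_cong:
  assumes "\<And>d. cover v c d \<Longrightarrow> f (exchange v c d) = g (exchange v c d)"
  shows "monk_sum f c v = monk_sum g c v"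
  unfolding monk_sum_def using assms by (intro sum.cong) auto

lemma monk_sum_linear: "monk_sum (\<lambda>v. f v + x * g v) c v = monk_sum f c v + x * monk_sum g c v"
  unfolding monk_sum_def sum_distrib_left sum.distrib[symmetric]
  by (intro sum.cong) (auto simp: algebra_simps)

text \<open>
  Together with the next lemma, this is the lifting property of the Bruhat order for a covering
  pair and an adjacent exchange.
\<close>

lemma rises_keeps_ascent:
  assumes v: "inj v" and asc: "v i < v (i + 1)" and ab: "rises v a b" and ne: "(a, b) \<noteq> (i, i + 1)"
  shows "exchange v a b i < exchange v a b (i + 1)"
proof -
  have "v i \<noteq> v a" if "i \<noteq> a" using that by (simp add: inj_eq[OF v])
  moreover have "v (i+1) \<noteq> v a" if "i + 1 \<noteq> a" using that by (simp add: inj_eq[OF v])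
  moreover have "v i \<noteq> v b" if "i \<noteq> b" using that by (simp add: inj_eq[OF v])
  moreover have "v (i+1) \<noteq> v b" if "i + 1 \<noteq> b" using that by (simp add: inj_eq[OF v])
  moreover have "a < i \<and> i < b \<longrightarrow> \<not> (v a < v i \<and> v i < v b)"
    "a < i+1 \<and> i+1 < b \<longrightarrow> \<not> (v a < v (i+1) \<and> v (i+1) < v b)"
    "a < b" "v a < v b"
    using ab by (auto simp: rises_def)
  ultimately show ?thesis
    using asc ne by (auto simp: exchange_apply)
qed

text \<open>
  Outside the exchange of \<open>i\<close> and \<open>i + 1\<close> itself, conjugation matches the covers of \<open>v\<close> that keep
  the descent at \<open>i\<close> with all covers of the permutation without that descent. Apart from
  \<open>i\<close> and \<open>i + 1\<close>, both sides test the same entries, so only the cases where \<open>a\<close> or \<open>b\<close> is one of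
  these two positions need a look.
\<close>

lemma rises_conj:
  assumes v: "inj v" and i: "1 \<le> i" and desc: "v (i + 1) < v i" and ne: "{a, b} \<noteq> {i, i + 1}"
  shows "(rises v a b \<and> exchange v a b (i + 1) < exchange v a b i) \<longleftrightarrow>
         rises (exchange v i (i + 1)) (transpose i (i + 1) a) (transpose i (i + 1) b)" (is "?L \<longleftrightarrow> ?R")
proof (cases "1 \<le> a \<and> a < b")
  case False
  then have "\<not> (1 \<le> transpose i (i + 1) a \<and> transpose i (i + 1) a < transpose i (i + 1) b)"
    using i ne by (auto simp: transpose_def split: if_splits)
  then show ?thesis using False by (auto simp: rises_def)
next
  case True
  have two: "(\<forall>e. Q e) \<longleftrightarrow> Q i \<and> Q (i + 1) \<and> (\<forall>e. e \<noteq> i \<and> e \<noteq> i + 1 \<longrightarrow> Q e)"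
    for Q :: "nat \<Rightarrow> bool"
    by metis
  have rises_iff: "rises x p q \<longleftrightarrow> 1 \<le> p \<and> p < q \<and> x p < x q \<and>
      \<not> (p < i \<and> i < q \<and> x p < x i \<and> x i < x q) \<and>
      \<not> (p < i + 1 \<and> i + 1 < q \<and> x p < x (i + 1) \<and> x (i + 1) < x q) \<and>
      (\<forall>e. e \<noteq> i \<and> e \<noteq> i + 1 \<longrightarrow> p < e \<and> e < q \<longrightarrow> \<not> (x p < x e \<and> x e < x q))" for x p q
    unfolding rises_def by (subst two) blast
  have inj: "v x = v y \<longleftrightarrow> x = y" for x y by (rule inj_eq[OF v])
  consider "a = i" "b > i + 1" | "a = i + 1" "b > i + 1" | "a < i" "b = i" | "a < i" "b = i + 1"
    | "a \<noteq> i" "a \<noteq> i + 1" "b \<noteq> i" "b \<noteq> i + 1"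
    using True ne unfolding doubleton_eq_iff by arith
  then show ?thesis
  proof cases
    case 1
    then show ?thesis using desc i unfolding rises_iff by (auto simp: exchange_apply)
  next
    case 2
    then show ?thesis using desc i inj[of b i] unfolding rises_iff
      by (auto simp: exchange_apply)
  next
    case 3
    then show ?thesis using desc True inj[of "i+1" a] unfolding rises_iff
      by (auto simp: exchange_apply)
  next
    case 4
    then show ?thesis using desc True unfolding rises_iff by (auto simp: exchange_apply)
  next
    case 5
    then show ?thesis using desc True unfolding rises_iff by (auto simp: exchange_apply)
  qed
qed

text \<open>
  The Leibniz rule for the divided difference of a product with the variable \<open>x\<^sub>c\<close>, carried over to
  functions of a permutation by Monk's rule. Conjugation by the adjacent exchange matches the covers
  on both sides; the exchange of \<open>i\<close> and \<open>i + 1\<close> is the only one without a partner and gives the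
  correction terms.
\<close>

lemma monk_sum_divided_difference:
  assumes v: "is_perm v" and i: "1 \<le> i"
  shows "monk_sum (divided_difference Q i) c v = divided_difference (monk_sum Q (transpose i (i + 1) c)) i v
           + (if c = i then Q v else if c = i + 1 then - Q v else 0)"
proof -
  let ?s = "transpose i (i + 1)"
  define y where "y = exchange v i (i + 1)"
  define sg :: "nat \<Rightarrow> nat \<Rightarrow> 'a" where "sg = (\<lambda>c d. if c < d then 1 else - 1)"
  have inj: "inj v" by (rule is_perm_inj[OF v])
  have py: "is_perm y" unfolding y_def using v i by (intro is_perm_exchange) auto
  have yy: "exchange y i (i + 1) = v" by (simp add: y_def)
  have "v i \<noteq> v (i + 1)" by (simp add: inj_eq[OF inj])
  then consider (asc) "v i < v (i + 1)" | (desc) "v (i + 1) < v i" by linarith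
  then show ?thesis
  proof cases
    case asc
    have zero: "divided_difference Q i (exchange v c d) = 0" if "cover v c d" "{c, d} \<noteq> {i, i + 1}" for d
    proof -
      have "exchange v c d i < exchange v c d (i + 1)"
        using that rises_keeps_ascent[OF inj asc, of c d] rises_keeps_ascent[OF inj asc, of d c]
        by (auto simp: cover_def doubleton_eq_iff exchange_commute[of v d c])
      then show ?thesis by (simp add: divided_difference_def)
    qed
    have up: "cover v i (i + 1)" "cover v (i + 1) i" using asc i by (auto simp: cover_def rises_def)
    have "monk_sum (divided_difference Q i) c v = (\<Sum>d | cover v c d \<and> {c, d} = {i, i + 1}. sg c d * divided_difference Q i (exchange v c d))"
      unfolding monk_sum_def sg_def using zero finite_covers[OF v]
      by (intro sum.mono_neutral_right) auto
    also have "{d. cover v c d \<and> {c, d} = {i, i + 1}} =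
                 (if c = i then {i + 1} else if c = i + 1 then {i} else {})"
      using up by (auto simp: doubleton_eq_iff)
    finally have l: "monk_sum (divided_difference Q i) c v = (\<Sum>d\<in>(if c = i then {i + 1} else if c = i + 1 then {i} else {}).
                       sg c d * divided_difference Q i (exchange v c d))" .
    have "divided_difference Q i y = Q v"
      using asc yy by (simp add: divided_difference_def y_def exchange_apply del: exchange_exchange)
    moreover have "divided_difference (monk_sum Q (?s c)) i v = 0" using asc by (simp add: divided_difference_def)
    moreover have "exchange v (i + 1) i = y" by (simp add: y_def exchange_commute)
    ultimately show ?thesis
      unfolding l by (auto simp: sg_def y_def)
  next
    case desc
    define A where "A = {d. cover v c d \<and> exchange v c d (i + 1) < exchange v c d i}"
    have notup: "\<not> cover v i (i + 1)" "\<not> cover v (i + 1) i" using desc by (auto simp: cover_def rises_def)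
    have up: "cover y i (i + 1)" "cover y (i + 1) i"
      using desc i by (auto simp: cover_def rises_def y_def exchange_apply)
    have A_iff: "d \<in> A \<longleftrightarrow> cover y (?s c) (?s d)" if "{c, d} \<noteq> {i, i + 1}" for d
      using rises_conj[OF inj i desc, of c d] rises_conj[OF inj i desc, of d c] that
      by (auto simp: A_def cover_def y_def exchange_commute[of v d c] insert_commute)
    have A_ne: "{c, d} \<noteq> {i, i + 1}" if "d \<in> A" for d
      using that notup by (auto simp: A_def doubleton_eq_iff)
    (* B collects the covers of y that have a partner among the covers of v, C the one that
       has none and produces the correction term. *)
    define B where "B = {d. cover y (?s c) d \<and> {?s c, d} \<noteq> {i, i + 1}}"
    define C where "C = {d. cover y (?s c) d \<and> {?s c, d} = {i, i + 1}}"
    have s_pair: "{?s c, ?s d} = {i, i + 1} \<longleftrightarrow> {c, d} = {i, i + 1}" for d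
      by (auto simp: transpose_def doubleton_eq_iff)
    have "monk_sum (divided_difference Q i) c v = (\<Sum>d\<in>A. sg c d * divided_difference Q i (exchange v c d))"
      unfolding monk_sum_def sg_def A_def using finite_covers[OF v]
      by (intro sum.mono_neutral_right) (auto simp: divided_difference_def)
    also have "\<dots> = (\<Sum>d\<in>B. sg (?s c) d * Q (exchange y (?s c) d))"
    proof (rule sum.reindex_bij_witness[of _ ?s ?s])
      fix d assume d: "d \<in> A"
      then show "?s d \<in> B" using A_iff[OF A_ne[OF d]] A_ne[OF d] s_pair[of d] by (simp add: B_def)
      have "sg (?s c) (?s d) = sg c d"
        using A_ne[OF d] d by (auto simp: sg_def transpose_def A_def cover_def rises_def)
      then show "sg (?s c) (?s d) * Q (exchange y (?s c) (?s d)) = sg c d * divided_difference Q i (exchange v c d)"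
        using d unfolding A_def divided_difference_def y_def
        by (simp add: exchange_conj[of v c d i "i + 1", simplified])
    next
      fix d assume d: "d \<in> B"
      then have "{c, ?s d} \<noteq> {i, i + 1}" using s_pair[of "?s d"] by (simp add: B_def)
      then show "?s d \<in> A" using A_iff[of "?s d"] d by (simp add: B_def)
    qed auto
    finally have l: "monk_sum (divided_difference Q i) c v = (\<Sum>d\<in>B. sg (?s c) d * Q (exchange y (?s c) d))" .
    have "divided_difference (monk_sum Q (?s c)) i v = (\<Sum>d\<in>B \<union> C. sg (?s c) d * Q (exchange y (?s c) d))"
      using desc by (auto simp: divided_difference_def monk_sum_def sg_def y_def B_def C_def intro!: sum.cong)
    also have "\<dots> = (\<Sum>d\<in>B. sg (?s c) d * Q (exchange y (?s c) d))
                   + (\<Sum>d\<in>C. sg (?s c) d * Q (exchange y (?s c) d))"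
      using finite_covers[OF py] by (intro sum.union_disjoint) (auto simp: B_def C_def)
    also have "C = (if c = i then {i} else if c = i + 1 then {i + 1} else {})"
      using up by (auto simp: C_def transpose_def doubleton_eq_iff)
    finally have r: "divided_difference (monk_sum Q (?s c)) i v = monk_sum (divided_difference Q i) c v
      + (\<Sum>d\<in>(if c = i then {i} else if c = i + 1 then {i + 1} else {}).
           sg (?s c) d * Q (exchange y (?s c) d))"
      unfolding l .
    have "exchange y (i + 1) i = v" using yy by (simp add: exchange_commute)
    then show ?thesis
      unfolding r using yy by (auto simp: sg_def)
  qed
qed

section \<open>Reduced expressions and compatible sequences\<close>

lemma perm_length_adjacent_le:
  assumes v: "is_perm v" and i: "1 \<le> i"
  shows "perm_length (exchange v i (i + 1)) \<le> perm_length v + 1"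
proof (cases "v i < v (i + 1)")
  case False
  moreover have "v i \<noteq> v (i + 1)" by (simp add: inj_eq[OF is_perm_inj[OF v]])
  ultimately show ?thesis using perm_length_adjacent_descent[OF v i] by simp
qed (use perm_length_adjacent[OF v i] in simp)

lemma fold_exchange_props:
  assumes "\<forall>i\<in>set \<rho>. 1 \<le> i"
  shows "is_perm (fold (\<lambda>i v. exchange v i (i + 1)) \<rho> id)
       \<and> perm_length (fold (\<lambda>i v. exchange v i (i + 1)) \<rho> id) \<le> length \<rho>"
  using assms
proof (induction \<rho> rule: rev_induct)
  case Nil
  then show ?case using is_perm_id perm_length_id by (simp add: id_def)
next
  case (snoc i \<rho>)
  then show ?case
    using is_perm_exchange[of "fold (\<lambda>i v. exchange v i (i + 1)) \<rho> id" i "i + 1"]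
      perm_length_adjacent_le[of "fold (\<lambda>i v. exchange v i (i + 1)) \<rho> id" i]
    by (auto simp: id_def)
qed

text \<open>
  A product of adjacent exchanges is at most as long as the number of its factors. Hence
  dropping the last letter of a reduced expression must lower the length, so that this letter is a
  descent.
\<close>

lemma reduced_expressions_snoc:
  assumes v: "is_perm v"
  shows "\<rho> @ [i] \<in> reduced_expressions v \<longleftrightarrow>
         1 \<le> i \<and> v (i + 1) < v i \<and> \<rho> \<in> reduced_expressions (exchange v i (i + 1))"
proof -
  let ?u = "fold (\<lambda>i v. exchange v i (i + 1)) \<rho> id"
  have eq: "exchange ?u i (i + 1) = v \<longleftrightarrow> ?u = exchange v i (i + 1)"
    by (auto simp: exchange_exchange)
  show ?thesis
  proof
    assume l: "\<rho> @ [i] \<in> reduced_expressions v"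
    then have \<rho>: "\<forall>j\<in>set \<rho>. 1 \<le> j" "1 \<le> i" "?u = exchange v i (i + 1)" "length \<rho> + 1 = perm_length v"
      using eq by (auto simp: reduced_expressions_def)
    have "perm_length (exchange v i (i + 1)) < perm_length v"
      using fold_exchange_props[OF \<rho>(1)] \<rho>(3,4) by simp
    then have "\<not> v i < v (i + 1)" using perm_length_adjacent[OF v \<rho>(2)] by auto
    moreover have "v i \<noteq> v (i + 1)" by (simp add: inj_eq[OF is_perm_inj[OF v]])
    ultimately have "v (i + 1) < v i" by simp
    then show "1 \<le> i \<and> v (i + 1) < v i \<and> \<rho> \<in> reduced_expressions (exchange v i (i + 1))"
      using \<rho> perm_length_adjacent_descent[OF v \<rho>(2)] by (simp add: reduced_expressions_def)
  next
    assume "1 \<le> i \<and> v (i + 1) < v i \<and> \<rho> \<in> reduced_expressions (exchange v i (i + 1))"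
    then show "\<rho> @ [i] \<in> reduced_expressions v"
      using perm_length_adjacent_descent[OF v, of i] eq by (auto simp: reduced_expressions_def)
  qed
qed

lemma last_reduced_expression:
  assumes "is_perm v" "\<rho> \<in> reduced_expressions v" "\<rho> \<noteq> []"
  shows "1 \<le> last \<rho> \<and> v (last \<rho> + 1) < v (last \<rho>)"
  using assms reduced_expressions_snoc[of v "butlast \<rho>" "last \<rho>"] by simp

lemma finite_reduced_expressions: "is_perm v \<Longrightarrow> finite (reduced_expressions v)"
proof (induction "perm_length v" arbitrary: v rule: less_induct)
  case less
  obtain N where N: "\<forall>j\<ge>N. v j = j" using is_perm_bounded[OF less.prems] by blast
  let ?Descents = "{i. 1 \<le> i \<and> v (i + 1) < v i}"
  have "i < N" if "i \<in> ?Descents" for i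
  proof (rule ccontr)
    assume "\<not> i < N"
    then have "v i = i" "v (i + 1) = i + 1" using N by simp_all
    then show False using that by simp
  qed
  then have fin: "finite ?Descents" by (intro finite_subset[of ?Descents "{..<N}"]) auto
  have "reduced_expressions v
          \<subseteq> {[]} \<union> (\<Union>i\<in>?Descents. (\<lambda>\<rho>. \<rho> @ [i]) ` reduced_expressions (exchange v i (i + 1)))"
  proof
    fix \<rho> assume \<rho>: "\<rho> \<in> reduced_expressions v"
    show "\<rho> \<in> {[]} \<union> (\<Union>i\<in>?Descents. (\<lambda>\<rho>. \<rho> @ [i]) ` reduced_expressions (exchange v i (i + 1)))"
    proof (cases \<rho> rule: rev_cases)
      case (snoc \<rho>' i)
      then show ?thesis using \<rho> reduced_expressions_snoc[OF less.prems, of \<rho>' i] by auto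
    qed simp
  qed
  moreover have "finite (reduced_expressions (exchange v i (i + 1)))" if "i \<in> ?Descents" for i
    using that less.prems perm_length_adjacent_descent[OF less.prems, of i]
    by (intro less.hyps is_perm_exchange) auto
  ultimately show ?case using fin by (elim finite_subset) auto
qed

lemma compatible_length: "\<alpha> \<in> compatible \<rho> \<Longrightarrow> length \<alpha> = length \<rho>"
  by (simp add: compatible_def)

lemma compatible_last:
  assumes "\<alpha> \<in> compatible \<rho>" "\<rho> \<noteq> []"
  shows "last \<alpha> \<le> last \<rho>" "\<alpha> \<noteq> []" "x \<in> set \<alpha> \<Longrightarrow> x \<le> last \<alpha>"
proof -
  have l: "length \<alpha> = length \<rho>" using assms(1) by (rule compatible_length)
  show ne: "\<alpha> \<noteq> []" using l assms(2) by auto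
  have "\<alpha> ! (length \<rho> - 1) \<le> \<rho> ! (length \<rho> - 1)"
    using assms by (simp add: compatible_def)
  then show "last \<alpha> \<le> last \<rho>" using l ne assms(2) by (simp add: last_conv_nth)
  have "sorted (butlast \<alpha> @ [last \<alpha>])" using ne assms(1) by (simp add: compatible_def)
  then have "\<forall>x\<in>set (butlast \<alpha> @ [last \<alpha>]). x \<le> last \<alpha>" unfolding sorted_append by auto
  then show "x \<in> set \<alpha> \<Longrightarrow> x \<le> last \<alpha>" using ne by simp
qed

lemma compatible_snoc:
  "\<alpha> @ [n] \<in> compatible (\<rho> @ [i]) \<longleftrightarrow>
     \<alpha> \<in> compatible \<rho> \<and> 1 \<le> n \<and> n \<le> i \<and> (\<forall>x\<in>set \<alpha>. x \<le> n) \<and>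
     (\<rho> \<noteq> [] \<longrightarrow> last \<rho> < i \<longrightarrow> last \<alpha> < n)"
proof (cases "length \<alpha> = length \<rho>")
  case True
  let ?A = "\<alpha> @ [n]" and ?R = "\<rho> @ [i]"
  have asc: "(\<forall>j. Suc j < length ?R \<longrightarrow> ?R ! j < ?R ! Suc j \<longrightarrow> ?A ! j < ?A ! Suc j) \<longleftrightarrow>
      (\<forall>j. Suc j < length \<rho> \<longrightarrow> \<rho> ! j < \<rho> ! Suc j \<longrightarrow> \<alpha> ! j < \<alpha> ! Suc j) \<and>
      (\<rho> \<noteq> [] \<longrightarrow> last \<rho> < i \<longrightarrow> last \<alpha> < n)" (is "?L \<longleftrightarrow> ?M \<and> ?N")
  proof (intro iffI conjI)
    assume l: ?L
    show ?M
    proof (intro allI impI)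
      fix j assume "Suc j < length \<rho>" "\<rho> ! j < \<rho> ! Suc j"
      then show "\<alpha> ! j < \<alpha> ! Suc j" using l[rule_format, of j] True by (simp add: nth_append)
    qed
    show ?N
    proof (intro impI)
      assume ne: "\<rho> \<noteq> []" "last \<rho> < i"
      have s: "Suc (length \<rho> - 1) = length \<rho>" using ne by simp
      have "\<alpha> \<noteq> []" using ne True by auto
      then show "last \<alpha> < n"
        using l[rule_format, of "length \<rho> - 1"] ne True s
        by (auto simp: nth_append last_conv_nth)
    qed
  next
    assume r: "?M \<and> ?N"
    show ?L
    proof (intro allI impI)
      fix j assume j: "Suc j < length ?R" "?R ! j < ?R ! Suc j"
      show "?A ! j < ?A ! Suc j"
      proof (cases "Suc j = length \<rho>")
        case eq: True
        then have "\<rho> \<noteq> []" "\<alpha> \<noteq> []" "length \<rho> - 1 = j" using True by auto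
        then have "last \<rho> = \<rho> ! j" "last \<alpha> = \<alpha> ! j"
          using True by (auto simp: last_conv_nth)
        then show ?thesis using r j eq True \<open>\<rho> \<noteq> []\<close> by (simp add: nth_append)
      next
        case False
        then show ?thesis using r j True by (simp add: nth_append)
      qed
    qed
  qed
  have le: "(\<forall>j<length ?R. ?A ! j \<le> ?R ! j) \<longleftrightarrow> (\<forall>j<length \<rho>. \<alpha> ! j \<le> \<rho> ! j) \<and> n \<le> i"
    using True by (auto simp: nth_append less_Suc_eq)
  show ?thesis
    unfolding compatible_def mem_Collect_eq asc le using True by (auto simp: sorted_append)
qed (auto simp: compatible_def)

lemma finite_compatible: "finite (compatible \<rho>)"
proof -
  have "x \<le> Max (set \<rho>)" if "\<alpha> \<in> compatible \<rho>" "x \<in> set \<alpha>" for \<alpha> x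
  proof -
    have "\<rho> \<noteq> []" using that by (auto simp: compatible_def)
    then have "x \<le> last \<rho>" using compatible_last(1,3)[OF that(1)] that(2) order_trans by blast
    also have "\<dots> \<le> Max (set \<rho>)" using \<open>\<rho> \<noteq> []\<close> by simp
    finally show ?thesis .
  qed
  then have "compatible \<rho> \<subseteq> {\<alpha>. set \<alpha> \<subseteq> {..Max (set \<rho>)} \<and> length \<alpha> = length \<rho>}"
    by (auto simp: compatible_length)
  then show ?thesis by (rule finite_subset) (simp add: finite_lists_length_eq)
qed

section \<open>Schubert polynomials in finitely many variables\<close>

text \<open>
  In a compatible sequence the letters that carry the same variable strictly decrease along a
  reduced expression. The last condition therefore says that all letters carrying \<open>x\<^sub>n\<close> are at least
  \<open>i\<close>; raising \<open>i\<close> by one removes at most one letter.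
\<close>

definition bounded_pairs :: "nat \<Rightarrow> nat \<Rightarrow> (nat \<Rightarrow> nat) \<Rightarrow> (nat list \<times> nat list) set" where
  "bounded_pairs n i v = {(\<rho>, \<alpha>). \<rho> \<in> reduced_expressions v \<and> \<alpha> \<in> compatible \<rho> \<and>
     (\<forall>x\<in>set \<alpha>. x \<le> n) \<and> (\<rho> \<noteq> [] \<longrightarrow> last \<alpha> = n \<longrightarrow> i \<le> last \<rho>)}"

definition partial_schubert :: "nat \<Rightarrow> nat \<Rightarrow> (nat \<Rightarrow> nat) \<Rightarrow> int_mpoly" where
  "partial_schubert n i v = (\<Sum>(\<rho>, \<alpha>)\<in>bounded_pairs n i v. prod_list (map X \<alpha>))"

abbreviation truncated_schubert :: "nat \<Rightarrow> (nat \<Rightarrow> nat) \<Rightarrow> int_mpoly" where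
  "truncated_schubert n \<equiv> partial_schubert n n"

lemma finite_bounded_pairs: "is_perm v \<Longrightarrow> finite (bounded_pairs n i v)"
  by (rule finite_subset[of _ "Sigma (reduced_expressions v) compatible"])
    (auto simp: bounded_pairs_def finite_reduced_expressions finite_compatible)

lemma bounded_pairs_snoc:
  assumes v: "is_perm v" and n: "1 \<le> n" "n \<le> i"
  shows "(\<rho> @ [i], \<alpha> @ [n]) \<in> bounded_pairs n i v \<longleftrightarrow>
         v (i + 1) < v i \<and> (\<rho>, \<alpha>) \<in> bounded_pairs n (i + 1) (exchange v i (i + 1))"
proof -
  let ?y = "exchange v i (i + 1)"
  have y: "is_perm ?y" using n by (intro is_perm_exchange v) auto
  (* Two equal adjacent letters are excluded by reducedness: this makes the letters that
     carry the same variable strictly decreasing. *)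
  have ne: "last \<rho> \<noteq> i" if "\<rho> \<in> reduced_expressions ?y" "\<rho> \<noteq> []" "v (i + 1) < v i"
    using last_reduced_expression[OF y that(1,2)] that(3) by (auto simp: exchange_apply)
  have last: "last \<alpha> \<in> set \<alpha>" if "\<alpha> \<in> compatible \<rho>" "\<rho> \<noteq> []"
    using compatible_last(2)[OF that] by simp
  have "(last \<rho> < i \<longrightarrow> last \<alpha> < n) \<longleftrightarrow> (last \<alpha> = n \<longrightarrow> i + 1 \<le> last \<rho>)"
    if "\<rho> \<in> reduced_expressions ?y" "\<rho> \<noteq> []" "v (i + 1) < v i" "\<alpha> \<in> compatible \<rho>" "\<forall>x\<in>set \<alpha>. x \<le> n"
    using ne[OF that(1,2,3)] last[OF that(4,2)] that(5) by fastforce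
  then show ?thesis
    using n unfolding bounded_pairs_def by (auto simp: reduced_expressions_snoc[OF v] compatible_snoc)
qed

text \<open>
  Either the letter \<open>i\<close> does not carry \<open>x\<^sub>n\<close>, or it is the last letter and all earlier letters that
  carry \<open>x\<^sub>n\<close> are larger. Iterating this expresses a Schubert polynomial as a coefficient of the
  product of factors \<open>1 + x\<^sub>n u\<^sub>i\<close> in the nilCoxeter algebra, as found by Fomin and Stanley.
\<close>

lemma partial_schubert_step:
  assumes v: "is_perm v" and n: "1 \<le> n" "n \<le> i"
  shows "partial_schubert n i v = partial_schubert n (i + 1) v
           + X n * divided_difference (partial_schubert n (i + 1)) i v"
proof -
  let ?y = "exchange v i (i + 1)"
  let ?snoc = "\<lambda>(\<rho>, \<alpha>). (\<rho> @ [i], \<alpha> @ [n])"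
  let ?E = "{(\<rho>, \<alpha>) \<in> bounded_pairs n i v. \<rho> \<noteq> [] \<and> last \<alpha> = n \<and> last \<rho> = i}"
  have split: "bounded_pairs n i v = bounded_pairs n (i + 1) v \<union> ?E" by (auto simp: bounded_pairs_def)
  have disj: "bounded_pairs n (i + 1) v \<inter> ?E = {}" by (auto simp: bounded_pairs_def)
  have E: "?E = (if v (i + 1) < v i then ?snoc ` bounded_pairs n (i + 1) ?y else {})"
  proof (intro subset_antisym subsetI)
    fix p assume p: "p \<in> ?E"
    obtain \<rho> \<alpha> where q: "p = (\<rho>, \<alpha>)" by force
    have pr: "(\<rho>, \<alpha>) \<in> bounded_pairs n i v" "\<rho> \<noteq> []" "last \<alpha> = n" "last \<rho> = i" using p q by auto
    then have "\<alpha> \<noteq> []" using compatible_last(2)[of \<alpha> \<rho>] by (auto simp: bounded_pairs_def)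
    then have s: "\<rho> = butlast \<rho> @ [i]" "\<alpha> = butlast \<alpha> @ [n]"
      using pr by (metis append_butlast_last_id)+
    then have "v (i + 1) < v i" "(butlast \<rho>, butlast \<alpha>) \<in> bounded_pairs n (i + 1) ?y"
      using bounded_pairs_snoc[OF v n, of "butlast \<rho>" "butlast \<alpha>"] pr(1) by auto
    then show "p \<in> (if v (i + 1) < v i then ?snoc ` bounded_pairs n (i + 1) ?y else {})"
      using s q by (auto intro!: image_eqI[of _ _ "(butlast \<rho>, butlast \<alpha>)"])
  next
    fix p assume "p \<in> (if v (i + 1) < v i then ?snoc ` bounded_pairs n (i + 1) ?y else {})"
    then show "p \<in> ?E" using bounded_pairs_snoc[OF v n] by (auto split: if_splits)
  qed
  have "inj_on ?snoc (bounded_pairs n (i + 1) ?y)" by (auto simp: inj_on_def)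
  then have sumE: "(\<Sum>(\<rho>, \<alpha>)\<in>?E. prod_list (map X \<alpha>)) = X n * divided_difference (partial_schubert n (i + 1)) i v"
    unfolding E
    by (auto simp: sum.reindex divided_difference_def partial_schubert_def sum_distrib_left case_prod_unfold mult.commute
        intro!: sum.cong)
  have fin: "finite (bounded_pairs n (i + 1) v)" "finite ?E"
    by (rule finite_bounded_pairs[OF v]) (rule finite_subset[OF _ finite_bounded_pairs[OF v, of n i]], auto)
  have "partial_schubert n i v = (\<Sum>(\<rho>, \<alpha>)\<in>bounded_pairs n (i + 1) v \<union> ?E. prod_list (map X \<alpha>))"
    unfolding partial_schubert_def using split by (rule arg_cong)
  also have "\<dots> = partial_schubert n (i + 1) v + (\<Sum>(\<rho>, \<alpha>)\<in>?E. prod_list (map X \<alpha>))"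
    unfolding partial_schubert_def by (rule sum.union_disjoint[OF fin disj])
  finally show ?thesis unfolding sumE .
qed

text \<open>
  A letter that carries the variable of index \<open>Suc n\<close> would be at least \<open>i\<close>, and so would be the last
  letter, which is a descent of \<open>v\<close>.
\<close>

lemma partial_schubert_lower:
  assumes v: "is_perm v" and asc: "\<And>j. i \<le> j \<Longrightarrow> v j < v (j + 1)"
  shows "partial_schubert (Suc n) i v = truncated_schubert n v"
proof -
  have "bounded_pairs (Suc n) i v = bounded_pairs n n v"
  proof (intro subset_antisym subsetI)
    fix p assume p: "p \<in> bounded_pairs (Suc n) i v"
    obtain \<rho> \<alpha> where q: "p = (\<rho>, \<alpha>)" by force
    have pr: "\<rho> \<in> reduced_expressions v" "\<alpha> \<in> compatible \<rho>" "\<forall>x\<in>set \<alpha>. x \<le> Suc n"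
      "\<rho> \<noteq> [] \<Longrightarrow> last \<alpha> = Suc n \<Longrightarrow> i \<le> last \<rho>"
      using p q by (auto simp: bounded_pairs_def)
    show "p \<in> bounded_pairs n n v"
    proof (cases "\<rho> = []")
      case True
      then show ?thesis using pr q by (auto simp: bounded_pairs_def compatible_def)
    next
      case False
      note la = compatible_last[OF pr(2) False]
      have "\<not> i \<le> last \<rho>"
        using last_reduced_expression[OF v pr(1) False] asc[of "last \<rho>"] by auto
      then have "last \<alpha> \<noteq> Suc n" using pr(4)[OF False] by blast
      then have "last \<alpha> \<le> n" using pr(3) last_in_set[OF la(2)] le_Suc_eq by blast
      then have "\<forall>x\<in>set \<alpha>. x \<le> n" using la(3) order_trans by blast
      then show ?thesis using pr q la(1) by (auto simp: bounded_pairs_def)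
    qed
  next
    fix p assume p: "p \<in> bounded_pairs n n v"
    obtain \<rho> \<alpha> where q: "p = (\<rho>, \<alpha>)" by force
    then have "\<alpha> \<in> compatible \<rho>" "\<forall>x\<in>set \<alpha>. x \<le> n" using p by (auto simp: bounded_pairs_def)
    then have "last \<alpha> \<noteq> Suc n" if "\<rho> \<noteq> []"
      using compatible_last(2)[of \<alpha> \<rho>] that last_in_set[of \<alpha>] by force
    then show "p \<in> bounded_pairs (Suc n) i v" using p q by (fastforce simp: bounded_pairs_def)
  qed
  then show ?thesis by (simp add: partial_schubert_def)
qed

lemma truncated_schubert_0: "truncated_schubert 0 v = (if v = id then 1 else 0)"
proof -
  have "bounded_pairs 0 0 v = (if v = id then {([], [])} else {})"
  proof -
    have "\<alpha> = [] \<and> \<rho> = []" if "(\<rho>, \<alpha>) \<in> bounded_pairs 0 0 v" for \<rho> \<alpha>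
    proof -
      have "\<forall>x\<in>set \<alpha>. 1 \<le> x \<and> x \<le> 0" "length \<alpha> = length \<rho>"
        using that by (auto simp: bounded_pairs_def compatible_def)
      then show ?thesis by (cases \<alpha>) auto
    qed
    moreover have "([], []) \<in> bounded_pairs 0 0 v \<longleftrightarrow> v = id"
      using perm_length_id by (auto simp: bounded_pairs_def reduced_expressions_def compatible_def)
    ultimately show ?thesis by auto
  qed
  then show ?thesis by (simp add: partial_schubert_def)
qed

section \<open>Monk's rule for truncated Schubert polynomials\<close>

lemma monk_sum_partial_step:
  assumes v: "is_perm v" and n: "1 \<le> n" "n \<le> i"
  shows "monk_sum (partial_schubert n i) c v = monk_sum (partial_schubert n (i + 1)) c v
    + X n * (divided_difference (monk_sum (partial_schubert n (i + 1)) (transpose i (i + 1) c)) i v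
             + (if c = i then partial_schubert n (i + 1) v else if c = i + 1 then - partial_schubert n (i + 1) v else 0))"
proof -
  have "monk_sum (partial_schubert n i) c v = monk_sum (\<lambda>v. partial_schubert n (i + 1) v + X n * divided_difference (partial_schubert n (i + 1)) i v) c v"
    using is_perm_exchange_cover[OF v] n by (intro monk_sum_cong partial_schubert_step) auto
  also have "\<dots> = monk_sum (partial_schubert n (i + 1)) c v + X n * monk_sum (divided_difference (partial_schubert n (i + 1)) i) c v"
    by (rule monk_sum_linear)
  finally show ?thesis using n by (subst (asm) monk_sum_divided_difference[OF v]) simp_all
qed

lemma exchange_descent_fixed_tail:
  assumes v: "is_perm v" "\<forall>j\<ge>N. v j = j" and desc: "v (i + 1) < v i"
  shows "i + 1 < N \<and> (\<forall>j\<ge>N. exchange v i (i + 1) j = j)"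
proof -
  have "i + 1 < N"
  proof (rule ccontr)
    assume "\<not> i + 1 < N"
    then have "v (i + 1) = i + 1" "\<forall>j\<ge>i + 1. v j = j" using v(2) by auto
    then show False using fixed_tail_less[OF v(1), of "i + 1" i] desc by simp
  qed
  then show ?thesis using v(2) by (auto simp: exchange_apply)
qed

text \<open>
  For \<open>c < i\<close> the signed sum commutes with all the operators that lead from \<open>truncated_schubert n\<close> to
  \<open>partial_schubert (Suc n) i\<close>. The induction raises \<open>i\<close> until \<open>v\<close> fixes everything from \<open>i\<close> on.
\<close>

lemma monk_sum_partial_below:
  assumes kill: "\<And>c v. n < c \<Longrightarrow> is_perm v \<Longrightarrow> monk_sum (truncated_schubert n) c v = 0"
    and v: "is_perm v" and c: "n < c" "c < i"
  shows "monk_sum (partial_schubert (Suc n) i) c v = 0"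
proof -
  obtain N where "\<forall>j\<ge>N. v j = j" using is_perm_bounded[OF v] by blast
  then show ?thesis using v c(2)
  proof (induction "N - i" arbitrary: i v rule: less_induct)
    case less
    note fixed = less.prems(1) and v = less.prems(2) and ci = less.prems(3)
    show ?case
    proof (cases "N \<le> i")
      case True
      have fixed: "\<forall>j\<ge>i. v j = j" using fixed True by simp
      have "monk_sum (partial_schubert (Suc n) i) c v = monk_sum (truncated_schubert n) c v"
      proof (rule monk_sum_cong)
        fix d assume d: "cover v c d"
        (* The cover moves nothing beyond position i and puts an entry below i there, so
           there is still no descent from i on. *)
        have d_le: "d \<le> i" by (rule cover_bound[OF v fixed ci d])
        show "partial_schubert (Suc n) i (exchange v c d) = truncated_schubert n (exchange v c d)"
        proof (rule partial_schubert_lower[OF is_perm_exchange_cover[OF v d]])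
          fix j assume "i \<le> j"
          moreover have "v c < i" by (rule fixed_tail_less[OF v fixed ci])
          ultimately show "exchange v c d j < exchange v c d (j + 1)"
            using d_le fixed ci by (auto simp: exchange_apply)
        qed
      qed
      then show ?thesis using kill[OF c(1) v] by simp
    next
      case False
      let ?y = "exchange v i (i + 1)"
      have "monk_sum (partial_schubert (Suc n) (i + 1)) c v = 0"
        using fixed v ci False by (intro less.hyps) auto
      moreover have "divided_difference (monk_sum (partial_schubert (Suc n) (i + 1)) c) i v = 0"
      proof (cases "v (i + 1) < v i")
        case True
        moreover have "is_perm ?y" using c ci by (intro is_perm_exchange v) auto
        ultimately have "monk_sum (partial_schubert (Suc n) (i + 1)) c ?y = 0"
          using exchange_descent_fixed_tail[OF v fixed] ci False by (intro less.hyps) auto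
        then show ?thesis by (simp add: divided_difference_def)
      qed (simp add: divided_difference_def)
      moreover have "transpose i (i + 1) c = c" using ci by (simp add: transpose_def)
      ultimately show ?thesis using c ci by (subst monk_sum_partial_step[OF v]) auto
    qed
  qed
qed

text \<open>
  The main term and the correction term of the Leibniz rule recombine to the recursion of
  \<open>partial_schubert\<close>, times the variable. For \<open>i = Suc n\<close> this is Monk's rule for the last variable
  that is not set to zero.
\<close>

lemma monk_sum_partial_at:
  assumes kill: "\<And>c v. n < c \<Longrightarrow> is_perm v \<Longrightarrow> monk_sum (truncated_schubert n) c v = 0"
    and v: "is_perm v" and i: "n < i"
  shows "monk_sum (partial_schubert (Suc n) i) i v = X (Suc n) * partial_schubert (Suc n) i v"
proof -
  obtain N where "\<forall>j\<ge>N. v j = j" using is_perm_bounded[OF v] by blast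
  then show ?thesis using v i
  proof (induction "N - i" arbitrary: i v rule: less_induct)
    case less
    note fixed = less.prems(1) and v = less.prems(2) and i = less.prems(3)
    let ?y = "exchange v i (i + 1)" and ?f = "partial_schubert (Suc n) (i + 1)"
    have "monk_sum ?f i v = 0" by (rule monk_sum_partial_below[OF kill v i]) auto
    moreover have "divided_difference (monk_sum ?f (i + 1)) i v = X (Suc n) * divided_difference ?f i v"
    proof (cases "v (i + 1) < v i")
      case True
      have "is_perm ?y" using i by (intro is_perm_exchange v) auto
      then have "monk_sum ?f (i + 1) ?y = X (Suc n) * ?f ?y"
        using exchange_descent_fixed_tail[OF v fixed True] i by (intro less.hyps) auto
      then show ?thesis by (simp add: divided_difference_def)
    qed (simp add: divided_difference_def)
    ultimately have "monk_sum (partial_schubert (Suc n) i) i v = X (Suc n) * (X (Suc n) * divided_difference ?f i v + ?f v)"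
      using i by (subst monk_sum_partial_step[OF v]) auto
    then show ?case
      using i by (subst partial_schubert_step[OF v]) (auto simp: algebra_simps)
  qed
qed

text \<open>
  For \<open>c = i + 1\<close> the correction term of the Leibniz rule cancels the value given by
  \<open>monk_sum_partial_at\<close>; for larger \<open>c\<close> the signed sum commutes with the divided difference at \<open>i\<close>.
\<close>

lemma monk_sum_partial_above:
  assumes kill: "\<And>c v. n < c \<Longrightarrow> is_perm v \<Longrightarrow> monk_sum (truncated_schubert n) c v = 0"
    and v: "is_perm v" and i: "n < i" "i < c"
  shows "monk_sum (partial_schubert (Suc n) i) c v = 0"
  using v i
proof (induction "c - i" arbitrary: i v rule: less_induct)
  case less
  note v = less.prems(1) and i = less.prems(2,3)
  let ?y = "exchange v i (i + 1)" and ?f = "partial_schubert (Suc n) (i + 1)"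
  have y: "is_perm ?y" using i by (intro is_perm_exchange v) auto
  show ?case
  proof (cases "c = i + 1")
    case True
    have "monk_sum ?f c v = X (Suc n) * ?f v"
      unfolding True by (rule monk_sum_partial_at[OF kill v]) (use i in auto)
    moreover have "monk_sum ?f i ?y = 0" by (rule monk_sum_partial_below[OF kill y i(1)]) auto
    then have "divided_difference (monk_sum ?f i) i v = 0" by (simp add: divided_difference_def)
    ultimately show ?thesis using i True by (subst monk_sum_partial_step[OF v]) auto
  next
    case False
    have "monk_sum ?f c v = 0" "monk_sum ?f c ?y = 0" using i False v y by (auto intro!: less.hyps)
    moreover from this have "divided_difference (monk_sum ?f c) i v = 0" by (simp add: divided_difference_def)
    moreover have "transpose i (i + 1) c = c" using i False by (simp add: transpose_def)
    ultimately show ?thesis using i False by (subst monk_sum_partial_step[OF v]) auto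
  qed
qed

text \<open>
  Monk's rule after the variable \<open>x\<^sub>c\<close> has been set to zero. The induction starts because
  \<open>truncated_schubert 0\<close> is supported on the identity, which covers nothing.
\<close>

theorem monk_sum_truncated:
  assumes "is_perm v" "n < c"
  shows "monk_sum (truncated_schubert n) c v = 0"
  using assms
proof (induction n arbitrary: c v)
  case 0
  have "exchange v c d \<noteq> id" if "cover v c d" for d
  proof
    assume "exchange v c d = id"
    then have "exchange v c d c = c" "exchange v c d d = d" by simp_all
    then show False using that by (auto simp: exchange_apply cover_def rises_def split: if_splits)
  qed
  then have "monk_sum (truncated_schubert 0) c v = monk_sum (\<lambda>_. 0) c v"
    by (intro monk_sum_cong) (simp add: truncated_schubert_0)
  then show ?case by (simp add: monk_sum_def)
next
  case (Suc n)
  show ?case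
    by (rule monk_sum_partial_above[OF Suc.IH Suc.prems(1)]) (use Suc.prems in auto)
qed

section \<open>Chains of covers that straighten a permutation\<close>

definition up_sum :: "((nat \<Rightarrow> nat) \<Rightarrow> 'r::comm_ring_1) \<Rightarrow> nat \<Rightarrow> nat \<Rightarrow> (nat \<Rightarrow> nat) \<Rightarrow> 'r" where
  "up_sum f k c v = (\<Sum>a | a < k \<and> rises v a c. f (exchange v a c))"

text \<open>
  A sum over chains of covers from a permutation, with the \<open>m\<close> exchanges at the positions
  \<open>c, c + 1, \<dots>, c + m - 1\<close> in this order and the other position of each exchange below \<open>k\<close>. Chains
  with equal ends count separately.
\<close>

primrec chain_sum :: "((nat \<Rightarrow> nat) \<Rightarrow> 'r::comm_ring_1) \<Rightarrow> nat \<Rightarrow> nat \<Rightarrow> nat \<Rightarrow> (nat \<Rightarrow> nat) \<Rightarrow> 'r" where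
  "chain_sum f k 0 c = f"
| "chain_sum f k (Suc m) c = up_sum (chain_sum f k m (c + 1)) k c"

text \<open>
  The inverse of \<open>move_entry\<close>.
\<close>

definition insert_entry :: "(nat \<Rightarrow> nat) \<Rightarrow> nat \<Rightarrow> nat \<Rightarrow> (nat \<Rightarrow> nat)" where
  "insert_entry v k m =
     (\<lambda>i. if i = k then v (k + m) else if k < i \<and> i \<le> k + m then v (i - 1) else v i)"

lemma up_sum_cong:
  assumes "\<And>a. a < k \<Longrightarrow> rises v a c \<Longrightarrow> f (exchange v a c) = g (exchange v a c)"
  shows "up_sum f k c v = up_sum g k c v"
  unfolding up_sum_def using assms by (intro sum.cong) auto

lemma up_sum_Suc:
  "up_sum f (Suc k) c v = up_sum f k c v + (if rises v k c then f (exchange v k c) else 0)"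
proof -
  have "{a. a < Suc k \<and> rises v a c} =
          {a. a < k \<and> rises v a c} \<union> (if rises v k c then {k} else {})"
    by (auto simp: less_Suc_eq)
  moreover have "finite {a. a < k \<and> rises v a c}" by simp
  ultimately show ?thesis by (simp add: up_sum_def add.commute)
qed

lemma rises_cong: "(\<And>x. a \<le> x \<Longrightarrow> x \<le> b \<Longrightarrow> v x = z x) \<Longrightarrow> rises v a b \<longleftrightarrow> rises z a b"
  by (cases "a < b") (auto simp: rises_def)

lemma insert_entry_0 [simp]: "insert_entry v k 0 = v"
  by (auto simp: insert_entry_def)

lemma insert_entry_Suc:
  "insert_entry v k (Suc m) = exchange (insert_entry v (k + 1) m) k (k + 1)"
  by (rule ext) (auto simp: insert_entry_def exchange_apply)

lemma is_perm_insert_entry: "is_perm v \<Longrightarrow> 1 \<le> k \<Longrightarrow> is_perm (insert_entry v k m)"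
proof (induction m arbitrary: k)
  case (Suc m)
  then show ?case unfolding insert_entry_Suc by (intro is_perm_exchange) auto
qed simp

lemma perm_length_insert_entry:
  assumes "is_perm v" "1 \<le> k" "strict_mono_on {k..} v"
  shows "perm_length (insert_entry v k m) = perm_length v + m"
  using assms(2,3)
proof (induction m arbitrary: k)
  case (Suc m)
  have mono: "strict_mono_on {k + 1..} v" using Suc.prems(2) by (rule monotone_on_subset) auto
  have "insert_entry v (k + 1) m k < insert_entry v (k + 1) m (k + 1)"
    using strict_mono_onD[OF Suc.prems(2), of k "k + 1 + m"] by (simp add: insert_entry_def)
  then show ?case
    using Suc.IH[OF _ mono] Suc.prems(1)
      perm_length_adjacent[OF is_perm_insert_entry[OF assms(1), of "k + 1" m] Suc.prems(1)]
    by (simp add: insert_entry_Suc)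
qed simp

text \<open>
  The exchange lowers the entry at \<open>c\<close>, but by the covering condition not below the entries at
  \<open>k, \<dots>, c - 1\<close>, which are smaller than the old one.
\<close>

lemma rises_keeps_increasing:
  assumes "inj y" "strict_mono_on {k..} y" "a < k" "k \<le> c" "rises y a c"
  shows "strict_mono_on {k..} (exchange y a c)"
proof (rule strict_mono_onI)
  fix p q assume pq: "p \<in> {k..}" "q \<in> {k..}" "p < q"
  have lt: "y p < y q" using strict_mono_onD[OF assms(2) pq] .
  have "y p < y a" if "q = c"
  proof -
    have "\<not> (y a < y p \<and> y p < y c)" using assms(3,5) pq that by (auto simp: rises_def)
    moreover have "y p \<noteq> y a" using assms(3) pq by (simp add: inj_eq[OF assms(1)])
    ultimately show ?thesis using lt that by auto
  qed
  then show "exchange y a c p < exchange y a c q"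
    using lt pq assms(3,5) by (auto simp: exchange_apply rises_def)
qed

text \<open>
  The entry at \<open>k + 1\<close> lies between those at \<open>k\<close> and \<open>c\<close> and so blocks the exchange of \<open>k\<close> and \<open>c\<close>; by
  \<open>rises_keeps_increasing\<close> this persists along the chain.
\<close>

lemma chain_sum_Suc_bound:
  assumes "is_perm y" "strict_mono_on {k..} y" "k + 2 \<le> c"
  shows "chain_sum f (Suc k) m c y = chain_sum f k m c y"
  using assms
proof (induction m arbitrary: c y)
  case (Suc m)
  have "\<not> rises y k c"
    using strict_mono_onD[OF Suc.prems(2), of k "k + 1"]
      strict_mono_onD[OF Suc.prems(2), of "k + 1" c] Suc.prems(3)
    by (auto simp: rises_def)
  then have "chain_sum f (Suc k) (Suc m) c y = up_sum (chain_sum f (Suc k) m (c + 1)) k c y"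
    by (simp add: up_sum_Suc)
  also have "\<dots> = up_sum (chain_sum f k m (c + 1)) k c y"
  proof (rule up_sum_cong)
    fix a assume a: "a < k" "rises y a c"
    have "is_perm (exchange y a c)"
      using a Suc.prems by (intro is_perm_exchange) (auto simp: rises_def)
    moreover have "strict_mono_on {k..} (exchange y a c)"
      using rises_keeps_increasing[OF is_perm_inj[OF Suc.prems(1)] Suc.prems(2) a(1) _ a(2)] Suc.prems(3)
      by simp
    ultimately show "chain_sum f (Suc k) m (c + 1) (exchange y a c) = chain_sum f k m (c + 1) (exchange y a c)"
      using Suc.prems(3) by (intro Suc.IH) auto
  qed
  finally show ?case by simp
qed simp

text \<open>
  This isolates the chains whose second step exchanges \<open>k\<close> and \<open>k + 1\<close>. Performing that adjacent
  exchange first and conjugating turns such a chain into one that starts from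
  \<open>exchange v k (k + 1)\<close>, and there position \<open>k\<close>, which now has the larger entry, cannot itself be
  exchanged with \<open>k + 1\<close>.
\<close>

lemma up_sum_up_sum_Suc:
  assumes mono: "strict_mono_on {k..} v" and k: "1 \<le> k"
  shows "up_sum (up_sum f (k + 1) (k + 1)) k k v =
         up_sum (up_sum f k (k + 1)) k k v + up_sum f (k + 1) (k + 1) (exchange v k (k + 1))"
proof -
  let ?y = "exchange v k (k + 1)"
  have asc: "v k < v (k + 1)" using strict_mono_onD[OF mono, of k "k + 1"] by simp
  have "up_sum (up_sum f (k + 1) (k + 1)) k k v =
        (\<Sum>a | a < k \<and> rises v a k. up_sum f k (k + 1) (exchange v a k)
            + f (exchange (exchange v a k) k (k + 1)))"
    unfolding up_sum_def[of _ k k v]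
  proof (rule sum.cong[OF refl])
    fix a assume a: "a \<in> {a. a < k \<and> rises v a k}"
    then have "rises (exchange v a k) k (k + 1)"
      using asc k by (auto simp: rises_def exchange_apply)
    then show "up_sum f (k + 1) (k + 1) (exchange v a k)
        = up_sum f k (k + 1) (exchange v a k) + f (exchange (exchange v a k) k (k + 1))"
      by (simp add: up_sum_Suc)
  qed
  also have "\<dots> = up_sum (up_sum f k (k + 1)) k k v
        + (\<Sum>a | a < k \<and> rises v a k. f (exchange (exchange v a k) k (k + 1)))"
    by (simp add: sum.distrib up_sum_def[of _ k k v])
  also have "(\<Sum>a | a < k \<and> rises v a k. f (exchange (exchange v a k) k (k + 1))) = up_sum f k (k + 1) ?y"
    unfolding up_sum_def[of f]
  proof (rule sum.cong)
    have "rises v a k \<longleftrightarrow> rises ?y a (k + 1)" if "a < k" for a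
      using that asc unfolding rises_def
      by (auto simp: exchange_apply less_Suc_eq)
    then show "{a. a < k \<and> rises v a k} = {a. a < k \<and> rises ?y a (k + 1)}" by blast
  next
    fix a assume "a \<in> {a. a < k \<and> rises ?y a (k + 1)}"
    then have "a < k" by simp
    then show "f (exchange (exchange v a k) k (k + 1)) = f (exchange ?y a (k + 1))"
      unfolding exchange_conj[of v a k k "k + 1"] by (simp add: transpose_def)
  qed
  also have "up_sum f k (k + 1) ?y = up_sum f (k + 1) (k + 1) ?y"
    using asc by (simp add: up_sum_Suc rises_def exchange_apply)
  finally show ?thesis .
qed

lemma monk_sum_split:
  assumes "is_perm v"
  shows "monk_sum Q c v = (\<Sum>d | rises v c d. Q (exchange v c d)) - up_sum Q c c v"
proof -
  have "{d. cover v c d} = {d. rises v c d} \<union> {a. a < c \<and> rises v a c}"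
    by (auto simp: cover_def rises_def)
  moreover have "finite {d. rises v c d}"
    by (rule finite_subset[OF _ finite_covers[OF assms, of c]]) (auto simp: cover_def)
  ultimately have "monk_sum Q c v =
      (\<Sum>d | rises v c d. (if c < d then 1 else - 1) * Q (exchange v c d))
      + (\<Sum>d | d < c \<and> rises v d c. (if c < d then 1 else - 1) * Q (exchange v c d))"
    unfolding monk_sum_def by (simp only:) (rule sum.union_disjoint, auto simp: rises_def)
  also have "(\<Sum>d | rises v c d. (if c < d then 1 else - 1) * Q (exchange v c d))
      = (\<Sum>d | rises v c d. Q (exchange v c d))"
    by (intro sum.cong) (auto simp: rises_def)
  also have "(\<Sum>d | d < c \<and> rises v d c. (if c < d then 1 else - 1) * Q (exchange v c d))
      = - up_sum Q c c v"
    unfolding up_sum_def sum_negf[symmetric]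
    by (intro sum.cong) (auto simp: exchange_commute)
  finally show ?thesis by simp
qed

text \<open>
  For the step from \<open>m\<close> to \<open>Suc m\<close> let \<open>z\<close> be \<open>v\<close> with the entry at \<open>k + m + 1\<close> moved to \<open>k + 1\<close>.
  To the right of \<open>k\<close>, the permutation \<open>z\<close> has a cover at \<open>k + 1\<close>, which is the permutation wanted,
  and for \<open>m > 0\<close> one at \<open>k + 2\<close>. The vanishing signed sum at \<open>k\<close> thus expresses the value wanted
  by the covers of \<open>z\<close> to the left of \<open>k\<close>, minus the value at the second cover. All of these are of
  the form \<open>insert_entry _ (k + 1) m\<close>, so that the induction hypothesis applies with \<open>k + 1\<close> in place
  of \<open>k\<close>. In the resulting chains the other position may be \<open>k\<close> itself: in their step at \<open>k + 1\<close>
  these terms are removed by the subtracted value (\<open>up_sum_up_sum_Suc\<close>), and in later steps they do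
  not occur (\<open>chain_sum_Suc_bound\<close>).
\<close>

theorem insert_entry_chain_sum:
  fixes f :: "(nat \<Rightarrow> nat) \<Rightarrow> 'r::comm_ring_1"
  assumes "\<And>c v. k \<le> c \<Longrightarrow> is_perm v \<Longrightarrow> monk_sum f c v = 0"
    and "is_perm v" "strict_mono_on {k..} v" "1 \<le> k"
  shows "f (insert_entry v k m) = chain_sum f k m k v"
  using assms
proof (induction m arbitrary: k v)
  case (Suc m)
  note v = Suc.prems(2) and mono = Suc.prems(3) and k = Suc.prems(4)
  note lt = strict_mono_onD[OF mono]
  define z where "z = insert_entry v (k + 1) m"
  let ?y = "exchange v k (k + 1)"
  have pz: "is_perm z" unfolding z_def by (rule is_perm_insert_entry[OF v]) simp
  have IH: "f (insert_entry x (k + 1) m) = chain_sum f (k + 1) m (k + 1) x"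
    if "is_perm x" "strict_mono_on {k + 1..} x" for x
    using Suc.IH[of "k + 1" x] Suc.prems(1) that by simp
  have z_le: "z x = v x" if "x \<le> k" for x using that by (simp add: z_def insert_entry_def)
  (* For m > 0 the entries of z from position k on are v k, v (k + m + 1), v (k + 1), and so on;
     every entry beyond these is blocked by v (k + 1). *)
  have next1: "rises z k (k + 1)"
    using k lt[of k "k + 1 + m"] by (auto simp: rises_def z_def insert_entry_def)
  have next2: "rises z k (k + 2) \<longleftrightarrow> 0 < m"
  proof (cases "m = 0")
    case True
    then show ?thesis using lt[of k "k + 1"] lt[of "k + 1" "k + 2"] by (auto simp: rises_def z_def)
  next
    case False
    then have z: "z (k + 2) = v (k + 1)" "z (k + 1) = v (k + 1 + m)"
      by (simp_all add: z_def insert_entry_def)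
    have "\<not> z e < z (k + 2)" if "k < e" "e < k + 2" for e
    proof -
      have "e = k + 1" using that by simp
      then show ?thesis using z lt[of "k + 1" "k + 1 + m"] False by simp
    qed
    then show ?thesis
      using False k lt[of k "k + 1"] z z_le[of k] by (auto simp: rises_def)
  qed
  have later: "\<not> rises z k d" if "k + 2 < d" for d
  proof
    assume rises: "rises z k d"
    show False
    proof (cases "m = 0")
      case True
      then show ?thesis
        using rises that lt[of k "k + 1"] lt[of "k + 1" d] by (auto simp: rises_def z_def)
    next
      case False
      then have "z (k + 2) = v (k + 1)" by (simp add: z_def insert_entry_def)
      moreover have "v (k + 1) < z d"
        using that False lt[of "k + 1" d] lt[of "k + 1" "d - 1"] by (auto simp: z_def insert_entry_def)
      moreover have "\<not> (z k < z (k + 2) \<and> z (k + 2) < z d)"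
        using rises that by (simp add: rises_def)
      ultimately show ?thesis
        using lt[of k "k + 1"] z_le[of k] by simp
    qed
  qed
  have "{d. rises z k d} = {k + 1} \<union> (if m = 0 then {} else {k + 2})"
  proof (rule set_eqI)
    fix d
    have "d = k + 1 \<or> d = k + 2 \<or> k + 2 < d \<or> d \<le> k" by linarith
    then show "d \<in> {d. rises z k d} \<longleftrightarrow> d \<in> {k + 1} \<union> (if m = 0 then {} else {k + 2})"
      using next1 next2 later[of d] by (auto simp: rises_def)
  qed
  then have right: "(\<Sum>d | rises z k d. f (exchange z k d))
      = f (insert_entry v k (Suc m)) + (if m = 0 then 0 else f (exchange z k (k + 2)))"
    by (simp add: z_def insert_entry_Suc)
  have left: "up_sum f k k z = up_sum (chain_sum f (k + 1) m (k + 1)) k k v"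
    unfolding up_sum_def
  proof (rule sum.cong)
    show "{a. a < k \<and> rises z a k} = {a. a < k \<and> rises v a k}"
      using rises_cong[of _ k z v] z_le by auto
  next
    fix a assume "a \<in> {a. a < k \<and> rises v a k}"
    then have a: "a < k" "rises v a k" by auto
    have "exchange z a k = insert_entry (exchange v a k) (k + 1) m"
      unfolding z_def by (rule ext) (use a in \<open>auto simp: exchange_apply insert_entry_def\<close>)
    moreover have "is_perm (exchange v a k)"
      using a v by (intro is_perm_exchange) (auto simp: rises_def)
    moreover have "strict_mono_on {k + 1..} (exchange v a k)"
      by (rule monotone_on_subset[OF rises_keeps_increasing[OF is_perm_inj[OF v] mono a(1) _ a(2)]]) auto
    ultimately show "f (exchange z a k) = chain_sum f (k + 1) m (k + 1) (exchange v a k)"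
      using IH by simp
  qed
  have main: "f (insert_entry v k (Suc m)) + (if m = 0 then 0 else f (exchange z k (k + 2)))
      = up_sum (chain_sum f (k + 1) m (k + 1)) k k v"
    using Suc.prems(1)[OF le_refl pz] monk_sum_split[OF pz, of f k] right left by simp
  show ?case
  proof (cases m)
    case 0
    then show ?thesis using main by simp
  next
    case (Suc l)
    have "exchange z k (k + 2) = insert_entry ?y (k + 1) m"
      unfolding z_def by (rule ext) (use Suc in \<open>auto simp: exchange_apply insert_entry_def\<close>)
    moreover have "is_perm ?y" using v k by (intro is_perm_exchange) auto
    moreover have "strict_mono_on {k + 1..} ?y"
      by (rule strict_mono_onI) (use lt in \<open>auto simp: exchange_apply\<close>)
    ultimately have "f (exchange z k (k + 2)) = up_sum (chain_sum f (k + 1) l (k + 2)) (k + 1) (k + 1) ?y"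
      using IH Suc by simp
    then have "f (insert_entry v k (Suc m)) = up_sum (up_sum (chain_sum f (k + 1) l (k + 2)) k (k + 1)) k k v"
      using main up_sum_up_sum_Suc[OF mono k, of "chain_sum f (k + 1) l (k + 2)"] Suc by simp
    also have "\<dots> = up_sum (up_sum (chain_sum f k l (k + 2)) k (k + 1)) k k v"
    proof (intro up_sum_cong)
      fix a b assume a: "a < k" "rises v a k" and b: "b < k" "rises (exchange v a k) b (k + 1)"
      have p: "is_perm (exchange v a k)"
        using a v by (intro is_perm_exchange) (auto simp: rises_def)
      have m: "strict_mono_on {k..} (exchange v a k)"
        by (rule rises_keeps_increasing[OF is_perm_inj[OF v] mono a(1) _ a(2)]) simp
      have "is_perm (exchange (exchange v a k) b (k + 1))"
        by (rule is_perm_exchange[OF p]) (use b in \<open>auto simp: rises_def\<close>)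
      moreover have "strict_mono_on {k..} (exchange (exchange v a k) b (k + 1))"
        by (rule rises_keeps_increasing[OF is_perm_inj[OF p] m b(1) _ b(2)]) simp
      ultimately show "chain_sum f (k + 1) l (k + 2) (exchange (exchange v a k) b (k + 1))
          = chain_sum f k l (k + 2) (exchange (exchange v a k) b (k + 1))"
        using chain_sum_Suc_bound[of _ k "k + 2" f l] by simp
    qed
    finally show ?thesis using Suc by simp
  qed
qed simp

text \<open>
  The definition splits off the first exchange of a chain, as the straightening needs; counting the
  ends needs the last one.
\<close>

lemma chain_sum_Suc_last: "chain_sum f k (Suc m) c = chain_sum (up_sum f k (c + m)) k m c"
proof (induction m arbitrary: c)
  case (Suc m)
  show ?case using Suc[of "c + 1"] by simp
qed simp

definition chain_ends :: "(nat \<Rightarrow> nat) \<Rightarrow> nat \<Rightarrow> nat \<Rightarrow> (nat \<Rightarrow> nat) set" where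
  "chain_ends v k m = {u. \<exists>a. u = swaps v a k m \<and> (\<forall>i\<in>{1..m}. 1 \<le> a i \<and> a i < k) \<and>
                             length_raising v a k m}"

lemma swaps_cong: "(\<And>i. i \<in> {1..m} \<Longrightarrow> a i = b i) \<Longrightarrow> swaps v a k m = swaps v b k m"
  by (induction m) auto

lemma is_perm_swaps:
  "is_perm v \<Longrightarrow> 1 \<le> k \<Longrightarrow> \<forall>i\<in>{1..m}. 1 \<le> a i \<Longrightarrow> is_perm (swaps v a k m)"
  by (induction m) (auto intro!: is_perm_exchange)

lemma swaps_beyond:
  "\<forall>i\<in>{1..m}. a i < k \<Longrightarrow> k + m \<le> x \<Longrightarrow> swaps v a k m x = v x"
proof (induction m)
  case (Suc m)
  have "a (Suc m) < k" using Suc.prems(1) by (rule bspec) simp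
  then have "x \<noteq> a (Suc m)" "x \<noteq> k + m" using Suc.prems(2) by simp_all
  then show ?case using Suc by (simp add: exchange_apply)
qed simp

lemma chain_ends_Suc:
  assumes v: "is_perm v" and k: "1 \<le> k"
  shows "chain_ends v k (Suc m) =
    (\<lambda>(u, a). exchange u a (k + m)) ` (SIGMA u:chain_ends v k m. {a. a < k \<and> rises u a (k + m)})"
    (is "?L = ?R")
proof (intro subset_antisym subsetI)
  fix u assume "u \<in> ?L"
  then obtain a where a: "u = swaps v a k (Suc m)" "\<forall>i\<in>{1..Suc m}. 1 \<le> a i \<and> a i < k"
    "length_raising v a k (Suc m)" by (auto simp: chain_ends_def)
  let ?u = "swaps v a k m"
  have u: "?u \<in> chain_ends v k m" using a by (auto simp: chain_ends_def length_raising_def)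
  have "is_perm ?u" using a by (intro is_perm_swaps v k) auto
  moreover have "1 \<le> a (Suc m)" "a (Suc m) < k" using bspec[OF a(2), of "Suc m"] by simp_all
  moreover have "perm_length (exchange ?u (a (Suc m)) (k + m)) = perm_length ?u + 1"
    using a(3) by (auto simp: length_raising_def)
  ultimately have "rises ?u (a (Suc m)) (k + m)"
    by (subst rises_iff_length) simp_all
  then show "u \<in> ?R" using a u by (intro image_eqI[of _ _ "(?u, a (Suc m))"]) auto
next
  fix u assume "u \<in> ?R"
  then obtain y b where y: "u = exchange y b (k + m)" "y \<in> chain_ends v k m" "b < k" "rises y b (k + m)"
    by auto
  then obtain a where a: "y = swaps v a k m" "\<forall>i\<in>{1..m}. 1 \<le> a i \<and> a i < k" "length_raising v a k m"
    by (auto simp: chain_ends_def)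
  define c where "c = a(Suc m := b)"
  have same: "swaps v c k i = swaps v a k i" if "i \<le> m" for i
    using that by (intro swaps_cong) (auto simp: c_def)
  have b: "1 \<le> b" using y by (simp add: rises_def)
  have "is_perm y" unfolding a(1) using a by (intro is_perm_swaps v k) auto
  then have "perm_length u = perm_length y + 1"
    using y b rises_iff_length[of y b "k + m"] by simp
  then have "length_raising v c k (Suc m)"
    using a y same by (auto simp: length_raising_def less_Suc_eq c_def)
  moreover have "u = swaps v c k (Suc m)" using y a same[of m] by (simp add: c_def)
  moreover have "\<forall>i\<in>{1..Suc m}. 1 \<le> c i \<and> c i < k" using a y b by (auto simp: c_def)
  ultimately show "u \<in> ?L" unfolding chain_ends_def by blast
qed

lemma chain_ends_props:
  assumes "is_perm v" "1 \<le> k" "u \<in> chain_ends v k m"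
  shows "is_perm u" "perm_length u = perm_length v + m" "k + m \<le> x \<Longrightarrow> u x = v x"
    and "strict_mono_on {k..} v \<Longrightarrow> strict_mono_on {k..} u"
proof -
  obtain a where a: "u = swaps v a k m" "\<forall>i\<in>{1..m}. 1 \<le> a i \<and> a i < k" "length_raising v a k m"
    using assms(3) by (auto simp: chain_ends_def)
  show "is_perm u" unfolding a(1) using a by (intro is_perm_swaps assms) auto
  show "k + m \<le> x \<Longrightarrow> u x = v x" unfolding a(1) using a by (intro swaps_beyond) auto
  have "j \<le> m \<Longrightarrow> perm_length (swaps v a k j) = perm_length v + j" for j
    using a(3) by (induction j) (auto simp: length_raising_def)
  then show "perm_length u = perm_length v + m" by (simp add: a(1))
  show "strict_mono_on {k..} u" if "strict_mono_on {k..} v"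
    using assms(3)
  proof (induction m arbitrary: u)
    case 0
    then show ?case using that by (auto simp: chain_ends_def)
  next
    case (Suc m)
    then obtain y b where y: "u = exchange y b (k + m)" "y \<in> chain_ends v k m" "b < k" "rises y b (k + m)"
      unfolding chain_ends_Suc[OF assms(1,2)] by auto
    obtain c where c: "y = swaps v c k m" "\<forall>i\<in>{1..m}. 1 \<le> c i \<and> c i < k"
      using y(2) by (auto simp: chain_ends_def)
    have "is_perm y" unfolding c(1) using c by (intro is_perm_swaps assms) auto
    then show ?case
      unfolding y(1) using rises_keeps_increasing[OF is_perm_inj Suc.IH[OF y(2)] y(3) _ y(4)] by simp
  qed
qed

text \<open>
  No two chains have the same end. Position \<open>k + m\<close> still has its original entry before the last of
  \<open>Suc m\<close> exchanges, so the end shows where that exchange put this entry, and the exchange can be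
  undone.
\<close>

lemma chain_sum_eq_sum_chain_ends:
  assumes v: "is_perm v" and k: "1 \<le> k"
  shows "chain_sum f k m k v = (\<Sum>u\<in>chain_ends v k m. f u) \<and> finite (chain_ends v k m)"
proof (induction m arbitrary: f)
  case 0
  have "chain_ends v k 0 = {v}" by (auto simp: chain_ends_def length_raising_def)
  then show ?case by simp
next
  case (Suc m)
  let ?S = "SIGMA u:chain_ends v k m. {a. a < k \<and> rises u a (k + m)}"
  have inj: "inj_on (\<lambda>(u, a). exchange u a (k + m)) ?S"
  proof (rule inj_onI, clarify)
    fix u a u' a'
    assume u: "u \<in> chain_ends v k m" "a < k" and u': "u' \<in> chain_ends v k m" "a' < k" "rises u' a' (k + m)"
      and eq: "exchange u a (k + m) = exchange u' a' (k + m)"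
    have "is_perm (exchange u' a' (k + m))"
      using chain_ends_props(1)[OF v k u'(1)] u' by (intro is_perm_exchange) (auto simp: rises_def)
    moreover have "exchange u' a' (k + m) a' = v (k + m)"
      using chain_ends_props(3)[OF v k u'(1), of "k + m"] by (simp add: exchange_apply)
    moreover have "exchange u' a' (k + m) a = v (k + m)"
      unfolding eq[symmetric] using chain_ends_props(3)[OF v k u(1), of "k + m"] by (simp add: exchange_apply)
    ultimately have "a = a'" using is_perm_inj by (metis injD)
    moreover from this have "u = u'" using eq exchange_exchange by metis
    ultimately show "u = u' \<and> a = a'" by simp
  qed
  have "chain_sum f k (Suc m) k v = (\<Sum>u\<in>chain_ends v k m. up_sum f k (k + m) u)"
    unfolding chain_sum_Suc_last using Suc by blast
  also have "\<dots> = (\<Sum>(u, a)\<in>?S. f (exchange u a (k + m)))"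
    unfolding up_sum_def using Suc by (intro sum.Sigma) auto
  also have "\<dots> = (\<Sum>u\<in>chain_ends v k (Suc m). f u)"
    unfolding chain_ends_Suc[OF v k] sum.reindex[OF inj] by (simp add: case_prod_unfold)
  finally have "chain_sum f k (Suc m) k v = (\<Sum>u\<in>chain_ends v k (Suc m). f u)" .
  moreover have "finite (chain_ends v k (Suc m))"
    unfolding chain_ends_Suc[OF v k] using Suc by auto
  ultimately show ?case by simp
qed

section \<open>Setting a variable to zero\<close>

lemma mpoly_subst_superset:
  assumes "finite A" "Poly_Mapping.keys p \<subseteq> A"
  shows "mpoly_subst s p = (\<Sum>t\<in>A. of_int (Poly_Mapping.lookup p t) *
           (\<Prod>i\<in>Poly_Mapping.keys t. s i ^ Poly_Mapping.lookup t i))"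
  unfolding mpoly_subst_def using assms
  by (intro sum.mono_neutral_left) (auto simp: in_keys_iff)

lemma mpoly_subst_add: "mpoly_subst s (p + q) = mpoly_subst s p + mpoly_subst s q"
proof -
  let ?A = "Poly_Mapping.keys p \<union> Poly_Mapping.keys q"
  have "Poly_Mapping.keys (p + q) \<subseteq> ?A" by (rule Poly_Mapping.keys_add)
  then show ?thesis
    by (simp add: mpoly_subst_superset[of ?A] lookup_add algebra_simps sum.distrib)
qed

lemma mpoly_subst_sum: "mpoly_subst s (\<Sum>x\<in>A. f x) = (\<Sum>x\<in>A. mpoly_subst s (f x))"
proof -
  have "mpoly_subst s 0 = 0" by (simp add: mpoly_subst_def)
  then show ?thesis by (induction A rule: infinite_finite_induct) (auto simp: mpoly_subst_add)
qed

lemma mpoly_subst_prod_list: "mpoly_subst s (prod_list (map X \<alpha>)) = prod_list (map s \<alpha>)"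
proof -
  define mon :: "nat list \<Rightarrow> nat \<Rightarrow>\<^sub>0 nat" where
    "mon = (\<lambda>\<alpha>. sum_list (map (\<lambda>i. Poly_Mapping.single i 1) \<alpha>))"
  have lookup: "Poly_Mapping.lookup (mon (j # \<alpha>)) i
      = (if i = j then 1 else 0) + Poly_Mapping.lookup (mon \<alpha>) i" for j \<alpha> i
    by (simp add: mon_def lookup_add lookup_single)
  have keys: "Poly_Mapping.keys (mon \<alpha>) = set \<alpha>" for \<alpha>
  proof (induction \<alpha>)
    case (Cons j \<alpha>)
    then show ?case by (auto simp: in_keys_iff lookup set_eq_iff split: if_splits)
  qed (simp add: mon_def)
  have eval: "(\<Prod>i\<in>set \<alpha>. s i ^ Poly_Mapping.lookup (mon \<alpha>) i) = prod_list (map s \<alpha>)"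
  proof (induction \<alpha>)
    case (Cons j \<alpha>)
    have "(\<Prod>i\<in>set (j # \<alpha>). s i ^ Poly_Mapping.lookup (mon (j # \<alpha>)) i)
        = (\<Prod>i\<in>set (j # \<alpha>). s i ^ (if i = j then 1 else 0))
          * (\<Prod>i\<in>set (j # \<alpha>). s i ^ Poly_Mapping.lookup (mon \<alpha>) i)"
      unfolding lookup power_add prod.distrib ..
    also have "(\<Prod>i\<in>set (j # \<alpha>). s i ^ (if i = j then 1 else 0))
        = (\<Prod>i\<in>set (j # \<alpha>). if i = j then s i else 1)"
      by (intro prod.cong) auto
    also have "\<dots> = s j" by simp
    also have "(\<Prod>i\<in>set (j # \<alpha>). s i ^ Poly_Mapping.lookup (mon \<alpha>) i)
        = (\<Prod>i\<in>set \<alpha>. s i ^ Poly_Mapping.lookup (mon \<alpha>) i)"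
      using keys[of \<alpha>] by (intro prod.mono_neutral_right) (auto simp: in_keys_iff)
    finally show ?case using Cons by simp
  qed simp
  have "prod_list (map X \<alpha>) = Poly_Mapping.single (mon \<alpha>) 1"
    by (induction \<alpha>) (auto simp: mon_def X_def mult_single)
  then show ?thesis by (simp add: mpoly_subst_def keys eval)
qed

lemma set_var_zero_prod_list:
  "set_var_zero k (prod_list (map X \<alpha>)) = (if k \<in> set \<alpha> then 0 else prod_list (map X \<alpha>))"
proof -
  have "prod_list (map (\<lambda>i. if i = k then 0 else X i) \<alpha>) = (if k \<in> set \<alpha> then 0 else prod_list (map X \<alpha>))"
    by (induction \<alpha>) auto
  then show ?thesis by (simp add: set_var_zero_def mpoly_subst_prod_list)
qed

lemma schubert_pairs:
  assumes "is_perm v"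
  shows "schubert v = (\<Sum>(\<rho>, \<alpha>)\<in>Sigma (reduced_expressions v) compatible. prod_list (map X \<alpha>))"
  unfolding schubert_def
  by (rule sum.Sigma) (auto simp: finite_reduced_expressions[OF assms] finite_compatible)

lemma bounded_pairs_diagonal:
  "bounded_pairs n n v = {(\<rho>, \<alpha>) \<in> Sigma (reduced_expressions v) compatible. \<forall>x\<in>set \<alpha>. x \<le> n}"
  using compatible_last(1) by (fastforce simp: bounded_pairs_def)

text \<open>
  The entries of a compatible sequence are bounded by the last letter, a descent of \<open>v\<close>.
\<close>

lemma compatible_le_descent:
  assumes "is_perm v" "\<rho> \<in> reduced_expressions v" "\<alpha> \<in> compatible \<rho>" "x \<in> set \<alpha>"
    and "\<And>j. n < j \<Longrightarrow> v j < v (j + 1)"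
  shows "x \<le> n"
proof -
  have ne: "\<rho> \<noteq> []" using assms(3,4) by (auto simp: compatible_def)
  have "x \<le> last \<rho>"
    using compatible_last(1)[OF assms(3) ne] compatible_last(3)[OF assms(3) ne assms(4)] by simp
  also have "last \<rho> \<le> n"
    using last_reduced_expression[OF assms(1,2) ne] assms(5)[of "last \<rho>"] by fastforce
  finally show ?thesis .
qed

lemma schubert_eq_truncated:
  assumes v: "is_perm v" and asc: "\<And>j. n < j \<Longrightarrow> v j < v (j + 1)"
  shows "schubert v = truncated_schubert n v"
proof -
  have "bounded_pairs n n v = Sigma (reduced_expressions v) compatible"
    unfolding bounded_pairs_diagonal using compatible_le_descent[OF v _ _ _ asc] by auto
  then show ?thesis by (simp add: schubert_pairs[OF v] partial_schubert_def)
qed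

lemma set_var_zero_schubert:
  assumes v: "is_perm v" and asc: "\<And>j. Suc n < j \<Longrightarrow> v j < v (j + 1)"
  shows "set_var_zero (Suc n) (schubert v) = truncated_schubert n v"
proof -
  let ?S = "Sigma (reduced_expressions v) compatible"
  have fin: "finite ?S"
    by (auto simp: finite_reduced_expressions[OF v] finite_compatible)
  have "set_var_zero (Suc n) (schubert v) = (\<Sum>(\<rho>, \<alpha>)\<in>?S. set_var_zero (Suc n) (prod_list (map X \<alpha>)))"
    unfolding schubert_pairs[OF v] set_var_zero_def mpoly_subst_sum by (simp add: case_prod_unfold)
  also have "\<dots> = (\<Sum>(\<rho>, \<alpha>)\<in>?S. if Suc n \<in> set \<alpha> then 0 else prod_list (map X \<alpha>))"
    by (simp add: set_var_zero_prod_list)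
  also have "\<dots> = (\<Sum>(\<rho>, \<alpha>)\<in>bounded_pairs n n v. prod_list (map X \<alpha>))"
  proof (rule sum.mono_neutral_cong_right[OF fin])
    show "bounded_pairs n n v \<subseteq> ?S" by (auto simp: bounded_pairs_def)
    show "\<forall>p\<in>?S - bounded_pairs n n v. (case p of (\<rho>, \<alpha>) \<Rightarrow> if Suc n \<in> set \<alpha> then 0 else prod_list (map X \<alpha>)) = 0"
    proof
      fix p assume p: "p \<in> ?S - bounded_pairs n n v"
      obtain \<rho> \<alpha> where q: "p = (\<rho>, \<alpha>)" by force
      then obtain x where "x \<in> set \<alpha>" "n < x" using p by (force simp: bounded_pairs_diagonal)
      moreover have "x \<le> Suc n"
        using compatible_le_descent[OF v _ _ \<open>x \<in> set \<alpha>\<close> asc] p q by auto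
      ultimately have "Suc n \<in> set \<alpha>" by (metis Suc_leI le_antisym)
      then show "(case p of (\<rho>, \<alpha>) \<Rightarrow> if Suc n \<in> set \<alpha> then 0 else prod_list (map X \<alpha>)) = 0"
        using q by simp
    qed
  qed (force simp: bounded_pairs_diagonal)
  finally show ?thesis by (simp add: partial_schubert_def)
qed

section \<open>Permutations with a given final descent\<close>

lemma is_perm_move_entry:
  assumes w: "is_perm w" and k: "1 \<le> k"
  shows "is_perm (move_entry w k m)"
proof (induction m)
  case 0
  have "move_entry w k 0 = w" by (auto simp: move_entry_def)
  then show ?case using w by simp
next
  case (Suc m)
  have "move_entry w k (Suc m) = exchange (move_entry w k m) (k + m) (k + m + 1)"
    by (rule ext) (auto simp: move_entry_def exchange_apply)
  then show ?case using is_perm_exchange[OF Suc] k by simp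
qed

lemma insert_entry_move_entry: "insert_entry (move_entry w k m) k m = w"
  by (rule ext) (auto simp: insert_entry_def move_entry_def)

lemma final_descent_mono:
  assumes "final_descent w k"
  shows "strict_mono_on {k + 1..} w"
proof (rule strict_mono_onI)
  fix i j assume "i \<in> {k + 1..}" "j \<in> {k + 1..}" "i < j"
  then show "w i < w j"
  proof (induction j)
    case (Suc j)
    then have "w j < w (Suc j)" using assms by (simp add: final_descent_def)
    then show ?case using Suc by (cases "i = j") auto
  qed simp
qed

text \<open>
  By the choice of \<open>m\<close>, the entry \<open>w k\<close> lies between \<open>w (k + m)\<close> and \<open>w (k + m + 1)\<close>.
\<close>

lemma move_entry_increasing:
  assumes w: "is_perm w" and d: "final_descent w k"
    and m: "k + m = Max {i. 1 \<le> i \<and> w k > w i}"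
  shows "strict_mono_on {k..} (move_entry w k m)"
proof -
  let ?S = "{i. 1 \<le> i \<and> w k > w i}"
  have inj: "inj w" by (rule is_perm_inj[OF w])
  have "finite (w -` {..<w k})" by (rule finite_vimageI[OF _ inj]) simp
  then have fin: "finite ?S" by (rule rev_finite_subset) auto
  have "k + 1 \<in> ?S" using d by (simp add: final_descent_def)
  then have in_S: "k + m \<in> ?S" unfolding m using fin by (intro Max_in) auto
  have below: "w k < w j" if "k + m < j" for j
  proof -
    have "j \<notin> ?S" using that Max_ge[OF fin, of j] m by auto
    moreover have "w j \<noteq> w k" using that by (simp add: inj_eq[OF inj])
    ultimately show ?thesis using that by auto
  qed
  note lt = strict_mono_onD[OF final_descent_mono[OF d]]
  show ?thesis
  proof (rule strict_mono_onI)
    fix p q assume pq: "p \<in> {k..}" "q \<in> {k..}" "p < q"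
    consider "q < k + m" | "q = k + m" | "p < k + m" "k + m < q" | "p = k + m" | "k + m < p"
      using pq by linarith
    then show "move_entry w k m p < move_entry w k m q"
    proof cases
      case 1
      then show ?thesis using pq lt[of "p + 1" "q + 1"] by (simp add: move_entry_def)
    next
      case 2
      have "w (p + 1) \<le> w (k + m)"
        using pq 2 lt[of "p + 1" "k + m"] by (cases "p + 1 = k + m") auto
      then show ?thesis using pq 2 in_S by (simp add: move_entry_def)
    next
      case 3
      then show ?thesis using pq lt[of "p + 1" q] by (simp add: move_entry_def)
    next
      case 4
      then show ?thesis using pq below[of q] by (simp add: move_entry_def)
    next
      case 5
      then show ?thesis using pq lt[of p q] by (simp add: move_entry_def)
    qed
  qed
qed

theorem theorem4p2:
  fixes w :: "nat \<Rightarrow> nat" and k m :: nat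
  assumes "is_perm w"
    and "final_descent w k"
    and "k + m = Max {i. 1 \<le> i \<and> w k > w i}"
  shows "set_var_zero k (schubert w) =
    (\<Sum>u\<in>{u. \<exists>a. u = swaps (move_entry w k m) a k m \<and>
                (\<forall>i\<in>{1..m}. 1 \<le> a i \<and> a i < k) \<and>
                perm_length u = perm_length w \<and>
                length_raising (move_entry w k m) a k m}. schubert u)"
proof -
  define v where "v = move_entry w k m"
  define n where "n = k - 1"
  have k: "1 \<le> k" "Suc n = k" using assms(2) by (auto simp: final_descent_def n_def)
  have v: "is_perm v" unfolding v_def by (rule is_perm_move_entry[OF assms(1) k(1)])
  have mono: "strict_mono_on {k..} v" unfolding v_def by (rule move_entry_increasing[OF assms])
  have w: "w = insert_entry v k m" by (simp add: v_def insert_entry_move_entry)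
  have "perm_length u = perm_length w" if "u \<in> chain_ends v k m" for u
    using chain_ends_props(2)[OF v k(1) that] perm_length_insert_entry[OF v k(1) mono, of m] w by simp
  then have ends: "{u. \<exists>a. u = swaps v a k m \<and> (\<forall>i\<in>{1..m}. 1 \<le> a i \<and> a i < k) \<and>
      perm_length u = perm_length w \<and> length_raising v a k m} = chain_ends v k m"
    unfolding chain_ends_def by blast
  have "set_var_zero k (schubert w) = truncated_schubert n w"
    using set_var_zero_schubert[OF assms(1), of n] assms(2) k(2) by (simp add: final_descent_def)
  also have "\<dots> = chain_sum (truncated_schubert n) k m k v"
    unfolding w by (rule insert_entry_chain_sum[OF monk_sum_truncated v mono k(1)]) (use k in auto)
  also have "\<dots> = (\<Sum>u\<in>chain_ends v k m. truncated_schubert n u)"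
    using chain_sum_eq_sum_chain_ends[OF v k(1)] by blast
  also have "\<dots> = (\<Sum>u\<in>chain_ends v k m. schubert u)"
  proof (rule sum.cong[OF refl])
    fix u assume u: "u \<in> chain_ends v k m"
    have "u j < u (j + 1)" if "n < j" for j
      using strict_mono_onD[OF chain_ends_props(4)[OF v k(1) u mono], of j "j + 1"] that k by simp
    then show "truncated_schubert n u = schubert u"
      by (intro schubert_eq_truncated[OF chain_ends_props(1)[OF v k(1) u], symmetric])
  qed
  finally show ?thesis unfolding ends v_def[symmetric] .
qed

end
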